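(* Let $(\Omega,\mathcal{F},\mathbb{P})$ be a probability space and $\mathcal{A}\subset\mathcal{F}$ a sub-$\sigma$-algebra such that $\mathcal{F}$ is conditionally atomless with respect to $\mathcal{A}$. Let $m\ge 1$ and let $X\colon\Omega\to\mathbb{R}^m$ be a square integrable random variable with $\mathbb{E}[X\mid\mathcal{A}]=0$. Let $(X_n)_{n\ge1}$ and $(Y_n)_{n\ge1}$ be sequences of square integrable $\mathbb{R}^m$-valued random variables such that $X_1=X$ and, for every $n\ge1$, $Y_n$ is a best approximation of $X_n$ that is independent of $\mathcal{A}$, and $X_{n+1}=X_n-Y_n$. Then $X_n\to 0$ in $L^2$. Consequently $X_1=\sum_{k\ge1}Y_k$, where the series converges in $L^2$. Moreover $\|X_1\|^2=\sum_{k\ge1}\|Y_k\|^2$.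
   Context: All random variables are $\mathcal{F}$-measurable. For an $\mathbb{R}^m$-valued random variable $Z$, $\|Z\|$ denotes the $L^2$ norm, $\|Z\|^2=\int_\Omega |Z|^2\,d\mathbb{P}$, where $|\cdot|$ is the Euclidean norm on $\mathbb{R}^m$. The $\sigma$-algebra $\mathcal{F}$ being conditionally atomless with respect to $\mathcal{A}$ is equivalent to (and may be taken to mean) the existence of an $\mathcal{F}$-measurable random variable $U$ that is uniformly distributed on $[0,1]$ and independent of $\mathcal{A}$. For a square integrable $Z\colon\Omega\to\mathbb{R}^m$, a best approximation of $Z$ that is independent of $\mathcal{A}$ is a square integrable random variable $Y\colon\Omega\to\mathbb{R}^m$ that is independent of $\mathcal{A}$ and satisfies $\|Z-Y\|\le\|Z-Z'\|$ for every square integrable random variable $Z'\colon\Omega\to\mathbb{R}^m$ that is independent of $\mathcal{A}$. *)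

theory Defs
  imports "HOL-Probability.Probability"
begin

text \<open>
  A sub-\<open>\<sigma>\<close>-algebra is given by a measure \<open>A\<close> with \<^const>\<open>subalgebra\<close> \<open>M A\<close>; this concerns
  only \<^const>\<open>space\<close> and \<^const>\<open>sets\<close>, and the values of the measure \<open>A\<close> are never used.
\<close>

definition indep_of_subalgebra ::
  "'a measure \<Rightarrow> 'a measure \<Rightarrow> ('a \<Rightarrow> 'b::topological_space) \<Rightarrow> bool" where
  "indep_of_subalgebra M A Z \<longleftrightarrow> Z \<in> borel_measurable M \<and>
     prob_space.indep_set M {Z -` B \<inter> space M | B. B \<in> sets borel} (sets A)"

text \<open>
  Conditional atomlessness, in its equivalent form as the existence of a uniform random variable
  on \<open>[0,1]\<close> that is independent of the sub-\<open>\<sigma>\<close>-algebra.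
\<close>
definition conditionally_atomless :: "'a measure \<Rightarrow> 'a measure \<Rightarrow> bool" where
  "conditionally_atomless M A \<longleftrightarrow>
     (\<exists>U :: 'a \<Rightarrow> real. U \<in> borel_measurable M \<and>
        distr M borel U = uniform_measure lborel {0..1} \<and>
        indep_of_subalgebra M A U)"

definition square_integrable :: "'a measure \<Rightarrow> ('a \<Rightarrow> real ^ 'm) \<Rightarrow> bool" where
  "square_integrable M Z \<longleftrightarrow>
     Z \<in> borel_measurable M \<and> integrable M (\<lambda>\<omega>. (norm (Z \<omega>))\<^sup>2)"

text \<open>
  Meaningful only for square integrable arguments: the integral of a non-integrable function is 0.
\<close>
definition L2norm :: "'a measure \<Rightarrow> ('a \<Rightarrow> real ^ 'm) \<Rightarrow> real" where
  "L2norm M Z = sqrt (\<integral>\<omega>. (norm (Z \<omega>))\<^sup>2 \<partial>M)"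

definition vec_cond_exp ::
  "'a measure \<Rightarrow> 'a measure \<Rightarrow> ('a \<Rightarrow> real ^ 'm) \<Rightarrow> 'a \<Rightarrow> real ^ 'm" where
  "vec_cond_exp M A Z \<omega> = (\<chi> i. real_cond_exp M A (\<lambda>\<nu>. Z \<nu> $ i) \<omega>)"

definition best_indep_approx ::
  "'a measure \<Rightarrow> 'a measure \<Rightarrow> ('a \<Rightarrow> real ^ 'm) \<Rightarrow> ('a \<Rightarrow> real ^ 'm) \<Rightarrow> bool" where
  "best_indep_approx M A Z Y \<longleftrightarrow>
     square_integrable M Y \<and> indep_of_subalgebra M A Y \<and>
     (\<forall>Z'. square_integrable M Z' \<and> indep_of_subalgebra M A Z' \<longrightarrow>
        L2norm M (\<lambda>\<omega>. Z \<omega> - Y \<omega>) \<le> L2norm M (\<lambda>\<omega>. Z \<omega> - Z' \<omega>))"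

end

theory Submission
  imports Defs
begin

text \<open>
  The square integrable variables independent of \<open>A\<close> form a cone, so the best approximation \<open>Y\<close>
  of \<open>X\<close> satisfies \<open>\<parallel>X - Y\<parallel>\<^sup>2 = \<parallel>X\<parallel>\<^sup>2 - \<parallel>Y\<parallel>\<^sup>2\<close> and \<open>\<bar>\<langle>X, Z\<rangle>\<bar> \<le> \<parallel>Y\<parallel> \<parallel>Z\<parallel>\<close> for every \<open>Z\<close> in the cone. The
  iteration is therefore a pure greedy algorithm, and Jones' argument applies: the norms
  \<open>a\<^sub>n = \<parallel>Y\<^sub>n\<parallel>\<close> are square summable, so \<open>a\<^sub>m (a\<^sub>1 + \<dots> + a\<^sub>m)\<close> is arbitrarily small for
  suitable \<open>m\<close>, which forces \<open>X\<^sub>n\<close> to be Cauchy. Its limit is orthogonal to everything independent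
  of \<open>A\<close> and has conditional expectation zero. Conditional atomlessness makes such a variable
  vanish, because a nonzero one can be tested against two events of conditional probability \<open>1/2\<close>
  that differ only where it is positive or negative.
\<close>

section \<open>Conditional probabilities\<close>

locale prob_subalgebra = prob_space M for M :: "'a measure" +
  fixes A :: "'a measure"
  assumes subalgebra: "subalgebra M A"

sublocale prob_subalgebra \<subseteq> finite_measure_subalgebra M A
  by unfold_locales (rule subalgebra)

context prob_subalgebra
begin

abbreviation cond_prob :: "'a set \<Rightarrow> 'a \<Rightarrow> real" where
  "cond_prob B \<equiv> real_cond_exp M A (indicator B)"

lemma subalgebra_sets [measurable_dest]: "G \<in> sets A \<Longrightarrow> G \<in> events"
  using subalgebra by (auto simp: subalgebra_def)

lemma space_subalgebra: "space A = space M"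
  using subalgebra by (auto simp: subalgebra_def)

lemma integrable_indicator_event: "B \<in> events \<Longrightarrow> integrable M (indicator B :: 'a \<Rightarrow> real)"
  by (simp add: emeasure_eq_measure)

lemma set_integral_indicator:
  assumes "B \<in> events" "G \<in> events"
  shows "(\<integral>x\<in>G. (indicator B x :: real) \<partial>M) = prob (B \<inter> G)"
proof -
  have "(\<lambda>x. indicator G x * indicator B x) = (indicator (B \<inter> G) :: 'a \<Rightarrow> real)"
    by (auto simp: indicator_def)
  then show ?thesis
    using assms by (simp add: set_lebesgue_integral_def sets.Int)
qed

lemma cond_prob_integral:
  assumes "B \<in> events" "G \<in> sets A"
  shows "(\<integral>x\<in>G. cond_prob B x \<partial>M) = prob (B \<inter> G)"
  using real_cond_exp_intA[OF integrable_indicator_event[OF assms(1)] assms(2)]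
    set_integral_indicator[OF assms(1) subalgebra_sets[OF assms(2)]] by simp

lemma integrable_cond_prob: "B \<in> events \<Longrightarrow> integrable M (cond_prob B)"
  by (rule real_cond_exp_int(1)[OF integrable_indicator_event])

lemma cond_prob_eqI:
  assumes "B \<in> events" "g \<in> borel_measurable A" "integrable M g"
    and "\<And>G. G \<in> sets A \<Longrightarrow> prob (B \<inter> G) = (\<integral>x\<in>G. g x \<partial>M)"
  shows "AE x in M. cond_prob B x = g x"
  by (rule real_cond_exp_charact)
    (use assms in \<open>auto simp: set_integral_indicator subalgebra_sets integrable_indicator_event\<close>)

lemma cond_prob_indep:
  assumes "B \<in> events" and "\<And>G. G \<in> sets A \<Longrightarrow> prob (B \<inter> G) = prob B * prob G"
  shows "AE x in M. cond_prob B x = prob B"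
proof (rule cond_prob_eqI)
  fix G assume G: "G \<in> sets A"
  have [measurable]: "G \<in> events" using G by (rule subalgebra_sets)
  have "(\<integral>x\<in>G. prob B \<partial>M) = prob B * prob G"
    unfolding set_lebesgue_integral_def by (simp add: mult.commute)
  then show "prob (B \<inter> G) = (\<integral>x\<in>G. prob B \<partial>M)" using assms(2)[OF G] by simp
qed (use assms in auto)

lemma cond_prob_disjoint_Un:
  assumes "B \<in> events" "C \<in> events" "B \<inter> C = {}"
  shows "AE x in M. cond_prob (B \<union> C) x = cond_prob B x + cond_prob C x"
proof -
  have "(indicator (B \<union> C) :: 'a \<Rightarrow> real) = (\<lambda>x. indicator B x + indicator C x)"
    using assms(3) by (auto simp: indicator_def fun_eq_iff)
  then show ?thesis
    using real_cond_exp_add[OF integrable_indicator_event[OF assms(1)]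
        integrable_indicator_event[OF assms(2)]] by simp
qed

lemma cond_prob_space: "AE x in M. cond_prob (space M) x = 1"
  by (rule AE_mp[OF cond_prob_indep[of "space M"]])
    (auto simp: prob_space Int_absorb1 sets.sets_into_space subalgebra_sets)

lemma cond_prob_nonneg: "B \<in> events \<Longrightarrow> AE x in M. 0 \<le> cond_prob B x"
  by (rule real_cond_exp_pos) auto

lemma cond_prob_le_1: "B \<in> events \<Longrightarrow> AE x in M. cond_prob B x \<le> 1"
  by (rule real_cond_exp_le_c) (auto simp: integrable_indicator_event indicator_def)

lemma cond_prob_compl:
  assumes "B \<in> events"
  shows "AE x in M. cond_prob (space M - B) x = 1 - cond_prob B x"
proof -
  have "AE x in M. cond_prob (B \<union> (space M - B)) x = cond_prob B x + cond_prob (space M - B) x"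
    by (rule cond_prob_disjoint_Un) (use assms in auto)
  moreover have "B \<union> (space M - B) = space M" using sets.sets_into_space[OF assms] by auto
  ultimately show ?thesis using cond_prob_space by auto
qed

text \<open>Independence turns the uniform law of \<open>U\<close> into a uniform conditional law
  given \<open>A\<close>, which is the form used below. Values outside (0,1] form a null set,
  because that interval has full measure under the uniform law.\<close>

lemma conditionally_atomlessE:
  assumes "conditionally_atomless M A"
  obtains U :: "'a \<Rightarrow> real" where "U \<in> borel_measurable M"
    and "\<And>s t. 0 \<le> s \<Longrightarrow> s \<le> t \<Longrightarrow> t \<le> 1 \<Longrightarrow>
      AE x in M. cond_prob {x \<in> space M. s < U x \<and> U x \<le> t} x = t - s"
    and "AE x in M. 0 < U x \<and> U x \<le> 1"
proof -
  obtain U :: "'a \<Rightarrow> real" where U [measurable]: "U \<in> borel_measurable M"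
    and distr: "distr M borel U = uniform_measure lborel {0..1}"
    and indep: "indep_of_subalgebra M A U"
    using assms by (auto simp: conditionally_atomless_def)
  have pr: "prob {x \<in> space M. s < U x \<and> U x \<le> t} = t - s"
    if "0 \<le> s" "s \<le> t" "t \<le> 1" for s t
  proof -
    have "{x \<in> space M. s < U x \<and> U x \<le> t} = U -` {s<..t} \<inter> space M" by auto
    then have "prob {x \<in> space M. s < U x \<and> U x \<le> t} = measure (distr M borel U) {s<..t}"
      by (simp add: measure_distr)
    also have "\<dots> = measure lborel ({0..1} \<inter> {s<..t}) / measure lborel {0..1::real}"
      unfolding distr by (rule measure_uniform_measure) auto
    also have "{0..1} \<inter> {s<..t} = {s<..t}" using that by auto
    finally show ?thesis using that by simp
  qed
  show thesis
  proof
    show "U \<in> borel_measurable M" by fact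
    fix s t :: real assume st: "0 \<le> s" "s \<le> t" "t \<le> 1"
    have "AE x in M. cond_prob {x \<in> space M. s < U x \<and> U x \<le> t} x
        = prob {x \<in> space M. s < U x \<and> U x \<le> t}"
    proof (rule cond_prob_indep)
      show "{x \<in> space M. s < U x \<and> U x \<le> t} \<in> events" by measurable
      fix G assume "G \<in> sets A"
      moreover have "{x \<in> space M. s < U x \<and> U x \<le> t} = U -` {s<..t} \<inter> space M" by auto
      ultimately show "prob ({x \<in> space M. s < U x \<and> U x \<le> t} \<inter> G)
          = prob {x \<in> space M. s < U x \<and> U x \<le> t} * prob G"
        using indep by (intro indep_setD[of "{U -` B \<inter> space M | B. B \<in> sets borel}" "sets A"])
          (auto simp: indep_of_subalgebra_def)
    qed
    then show "AE x in M. cond_prob {x \<in> space M. s < U x \<and> U x \<le> t} x = t - s"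
      using pr[OF st] by simp
  next
    have "{x \<in> space M. 0 < U x \<and> U x \<le> 1} \<in> events" by measurable
    then have "AE x in M. x \<in> {x \<in> space M. 0 < U x \<and> U x \<le> 1}"
      using pr[of 0 1] by (subst prob_eq_1[symmetric]) auto
    then show "AE x in M. 0 < U x \<and> U x \<le> 1" by auto
  qed
qed

text \<open>The set is cut out of \<open>D\<close> by \<open>U \<le> T\<close> for an \<open>A\<close>-measurable level \<open>T\<close>. The conditional
  probability of \<open>D \<inter> {U \<le> t}\<close> is 1-Lipschitz in \<open>t\<close>, so the smallest dyadic level \<open>N n / 2 ^ n\<close>
  at which it reaches \<open>g\<close> overshoots by at most \<open>1 / 2 ^ n\<close>.\<close>

lemma exists_subset_cond_prob_eq:
  assumes atomless: "conditionally_atomless M A"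
    and D [measurable]: "D \<in> events"
    and g [measurable]: "g \<in> borel_measurable A"
    and g_bounds: "AE x in M. 0 \<le> g x \<and> g x \<le> cond_prob D x"
  obtains B where "B \<in> events" "B \<subseteq> D" "AE x in M. cond_prob B x = g x"
proof -
  obtain U :: "'a \<Rightarrow> real" where U [measurable]: "U \<in> borel_measurable M"
    and U_unif: "\<And>s t. 0 \<le> s \<Longrightarrow> s \<le> t \<Longrightarrow> t \<le> 1 \<Longrightarrow>
      AE x in M. cond_prob {x \<in> space M. s < U x \<and> U x \<le> t} x = t - s"
    and U01: "AE x in M. 0 < U x \<and> U x \<le> 1"
    using conditionally_atomlessE[OF atomless] by blast
  have gM [measurable]: "g \<in> borel_measurable M"
    by (rule measurable_from_subalg[OF subalgebra g])
  have g1: "AE x in M. g x \<le> 1" using g_bounds cond_prob_le_1[OF D] by auto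
  have g_int: "integrable M g"
    by (rule integrable_const_bound[of _ 1]) (use g_bounds g1 in auto)
  define S where "S t = D \<inter> {x \<in> space M. U x \<le> t}" for t
  have S [measurable]: "S t \<in> events" for t unfolding S_def by measurable
  define F where "F t = cond_prob (S t)" for t
  have F_meas [measurable]: "F t \<in> borel_measurable A" for t unfolding F_def by simp
  have F_Lipschitz: "AE x in M. F t x \<le> F s x + (t - s)" if "0 \<le> s" "s \<le> t" "t \<le> 1" for s t
  proof -
    let ?I = "{x \<in> space M. s < U x \<and> U x \<le> t}"
    have I: "?I \<in> events" by measurable
    have "AE x in M. F t x \<le> real_cond_exp M A (\<lambda>x. indicator (S s) x + indicator ?I x) x"
      unfolding F_def
      by (intro real_cond_exp_mono integrable_indicator_event Bochner_Integration.integrable_add)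
        (use I in \<open>auto simp: S_def indicator_def\<close>)
    moreover have "AE x in M. real_cond_exp M A (\<lambda>x. indicator (S s) x + indicator ?I x) x
        = F s x + cond_prob ?I x"
      unfolding F_def using I by (intro real_cond_exp_add integrable_indicator_event) auto
    ultimately show ?thesis using U_unif[OF that] by auto
  qed
  have F_1: "AE x in M. F 1 x = cond_prob D x"
    unfolding F_def
    by (rule real_cond_exp_cong) (use U01 in \<open>auto simp: S_def indicator_def\<close>)
  have F_0: "AE x in M. F 0 x = 0"
  proof -
    have "AE x in M. F 0 x = cond_prob {} x"
      unfolding F_def by (rule real_cond_exp_cong) (use U01 in \<open>auto simp: S_def indicator_def\<close>)
    moreover have "AE x in M. cond_prob {} x = prob {}" by (rule cond_prob_indep) auto
    ultimately show ?thesis by auto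
  qed
  \<comment> \<open>Each \<open>F t\<close> is only a version of a conditional probability, so
    levels are confined to a dyadic grid, where countably many exceptional null sets suffice. The
    alternative \<open>2 ^ n \<le> k\<close> makes a least index exist at every point, exceptional
    ones included, and caps it at \<open>2 ^ n\<close>.\<close>
  define N where "N n x = (LEAST k::nat. 2 ^ n \<le> k \<or> g x \<le> F (k / 2 ^ n) x)" for n x
  have N_prop: "2 ^ n \<le> N n x \<or> g x \<le> F (N n x / 2 ^ n) x" for n x
    using LeastI[of "\<lambda>k. 2 ^ n \<le> k \<or> g x \<le> F (real k / 2 ^ n) x" "2 ^ n"]
    unfolding N_def by simp
  have N_le: "N n x \<le> 2 ^ n" for n x
    unfolding N_def by (rule Least_le) simp
  have N_less: "F (k / 2 ^ n) x < g x" if "k < N n x" for k n x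
    using not_less_Least[of k "\<lambda>k. 2 ^ n \<le> k \<or> g x \<le> F (k / 2 ^ n) x"] that
    unfolding N_def by auto
  have N_meas [measurable]: "N n \<in> measurable A (count_space UNIV)" for n
    unfolding N_def by measurable
  \<comment> \<open>Doubling an index and refining the grid leave the level unchanged, so the chosen
    levels decrease with \<open>n\<close> and the sets \<open>B n\<close> are nested.\<close>
  have N_Suc: "N (Suc n) x \<le> 2 * N n x" for n x
    unfolding N_def[of "Suc n"] by (rule Least_le) (use N_prop[of n x] in auto)
  define B where "B n = D \<inter> {x \<in> space M. U x \<le> N n x / 2 ^ n}" for n
  have NM [measurable]: "N n \<in> measurable M (count_space UNIV)" for n
    by (rule measurable_from_subalg[OF subalgebra N_meas])
  have B [measurable]: "B n \<in> events" for n unfolding B_def by measurable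
  have B_Suc: "B (Suc n) \<subseteq> B n" for n
  proof -
    have "real (N (Suc n) x) / 2 ^ Suc n \<le> real (N n x) / 2 ^ n" for x
    proof -
      have "real (N (Suc n) x) \<le> 2 * real (N n x)" using N_Suc[of n x] by linarith
      then show ?thesis by (simp add: field_simps)
    qed
    then show ?thesis unfolding B_def by (auto intro: order_trans)
  qed
  \<comment> \<open>\<open>N n\<close> is \<open>A\<close>-measurable with finitely many values, so
    \<open>B n\<close> splits over the sets \<open>?J k\<close>, whose indicators can be pulled out
    of the conditional expectation.\<close>
  have cond_B: "AE x in M. cond_prob (B n) x = F (N n x / 2 ^ n) x" for n
  proof -
    let ?J = "\<lambda>k. {x \<in> space A. N n x = k}"
    have J: "?J k \<in> sets A" for k by measurable
    have ind: "AE x in M. indicator (B n) x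
        = (\<Sum>k\<le>2 ^ n. indicator (?J k) x * indicator (S (k / 2 ^ n)) x :: real)"
    proof (rule AE_I2)
      fix x assume x: "x \<in> space M"
      have "(\<Sum>k\<le>2 ^ n. indicator (?J k) x * indicator (S (k / 2 ^ n)) x :: real)
          = (\<Sum>k\<le>2 ^ n. if N n x = k then indicator (S (N n x / 2 ^ n)) x else 0)"
        using x by (intro sum.cong) (auto simp: indicator_def space_subalgebra)
      also have "\<dots> = indicator (B n) x"
        using x N_le[of n x] by (auto simp: B_def S_def indicator_def)
      finally show "indicator (B n) x
        = (\<Sum>k\<le>2 ^ n. indicator (?J k) x * indicator (S (k / 2 ^ n)) x :: real)" by simp
    qed
    have int: "integrable M (\<lambda>x. indicator (?J k) x * indicator (S (k / 2 ^ n)) x :: real)" for k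
      using integrable_mult_indicator[OF subalgebra_sets[OF J]
          integrable_indicator_event[OF S]] by simp
    have "AE x in M. cond_prob (B n) x
        = real_cond_exp M A (\<lambda>x. \<Sum>k\<le>2 ^ n. indicator (?J k) x * indicator (S (k / 2 ^ n)) x) x"
      by (intro real_cond_exp_cong ind borel_measurable_sum borel_measurable_integrable int
          integrable_indicator_event B)
    moreover have "AE x in M.
        real_cond_exp M A (\<lambda>x. \<Sum>k\<le>2 ^ n. indicator (?J k) x * indicator (S (k / 2 ^ n)) x) x
        = (\<Sum>k\<le>2 ^ n. real_cond_exp M A (\<lambda>x. indicator (?J k) x * indicator (S (k / 2 ^ n)) x) x)"
      by (rule real_cond_exp_sum[OF int])
    moreover have "AE x in M. \<forall>k. real_cond_exp M A (\<lambda>x. indicator (?J k) x * indicator (S (k / 2 ^ n)) x) x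
        = indicator (?J k) x * F (k / 2 ^ n) x"
      unfolding AE_all_countable F_def
      using J int by (intro allI real_cond_exp_mult) auto
    ultimately show ?thesis using AE_space
    proof eventually_elim
      case (elim x)
      have "(\<Sum>k\<le>2 ^ n. indicator (?J k) x * F (k / 2 ^ n) x)
        = (\<Sum>k\<le>2 ^ n. if N n x = k then F (N n x / 2 ^ n) x else 0)"
        using elim by (intro sum.cong) (auto simp: indicator_def space_subalgebra)
      then show ?case using elim N_le[of n x] by simp
    qed
  qed
  have cond_B_bounds: "AE x in M. g x \<le> cond_prob (B n) x \<and> cond_prob (B n) x \<le> g x + 1 / 2 ^ n" for n
  proof -
    \<comment> \<open>A single null set must serve all \<open>k\<close>, since the index
      \<open>N n x\<close> varies with the point.\<close>
    have "AE x in M. \<forall>k<2 ^ n. F (Suc k / 2 ^ n) x \<le> F (k / 2 ^ n) x + 1 / 2 ^ n"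
      unfolding AE_all_countable
    proof (intro allI)
      fix k :: nat
      show "AE x in M. k < 2 ^ n \<longrightarrow> F (Suc k / 2 ^ n) x \<le> F (k / 2 ^ n) x + 1 / 2 ^ n"
      proof (cases "k < 2 ^ n")
        case True
        then have "real (Suc k) \<le> 2 ^ n" by (metis Suc_leI of_nat_le_iff of_nat_numeral of_nat_power)
        then have "AE x in M. F (Suc k / 2 ^ n) x \<le> F (k / 2 ^ n) x + (Suc k / 2 ^ n - k / 2 ^ n)"
          by (intro F_Lipschitz) (auto simp: divide_simps)
        moreover have "Suc k / 2 ^ n - k / 2 ^ n = (1 / 2 ^ n :: real)"
          by (simp add: diff_divide_distrib[symmetric])
        ultimately show ?thesis by simp
      qed simp
    qed
    then show ?thesis using cond_B[of n] F_0 F_1 g_bounds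
    proof eventually_elim
      case (elim x)
      have "g x \<le> F (N n x / 2 ^ n) x"
        using N_prop[of n x]
      proof
        assume "2 ^ n \<le> N n x"
        then have "N n x = 2 ^ n" using N_le[of n x] by simp
        then show ?thesis using elim by simp
      qed
      \<comment> \<open>At index 0 the value is 0, hence at most \<open>g x\<close>. Otherwise the
        preceding index was rejected, so its value is below \<open>g x\<close>, and one grid step
        adds at most \<open>1 / 2 ^ n\<close>.\<close>
      moreover have "F (N n x / 2 ^ n) x \<le> g x + 1 / 2 ^ n"
      proof (cases "N n x")
        case 0
        then show ?thesis using elim by simp
      next
        case (Suc k)
        then show ?thesis using N_less[of k n x] N_le[of n x] elim(1)[rule_format, of k] by simp
      qed
      ultimately show ?case using elim by simp
    qed
  qed
  show thesis
  proof
    show BM: "(\<Inter>n. B n) \<in> events" by (rule sets.countable_INT) auto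
    show "(\<Inter>n. B n) \<subseteq> D" by (auto simp: B_def)
    show "AE x in M. cond_prob (\<Inter>n. B n) x = g x"
    proof (rule cond_prob_eqI[OF BM g g_int])
      fix G assume G: "G \<in> sets A"
      have GM [measurable]: "G \<in> events" using G by (rule subalgebra_sets)
      \<comment> \<open>The same sequence is given two limits: continuity from above yields the
        probability of the intersection, the two-sided bounds yield the integral of
        \<open>g\<close>.\<close>
      have "(\<lambda>n. prob (B n \<inter> G)) \<longlonglongrightarrow> prob (\<Inter>n. B n \<inter> G)"
      proof (rule finite_Lim_measure_decseq)
        show "decseq (\<lambda>n. B n \<inter> G)" by (rule decseq_SucI) (rule Int_mono[OF B_Suc order_refl])
      qed auto
      moreover have "(\<lambda>n. prob (B n \<inter> G)) \<longlonglongrightarrow> (\<integral>x\<in>G. g x \<partial>M)"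
      proof (rule tendsto_sandwich[OF always_eventually always_eventually])
        have int1: "set_integrable M G g"
          using integrable_mult_indicator[OF GM g_int] by (simp add: set_integrable_def)
        have int2: "set_integrable M G (cond_prob (B n))" for n
          using integrable_mult_indicator[OF GM integrable_cond_prob[OF B]]
          by (simp add: set_integrable_def)
        have int3: "set_integrable M G (\<lambda>x. g x + 1 / 2 ^ n)" for n
          using integrable_mult_indicator[OF GM, of "\<lambda>x. g x + 1 / 2 ^ n"] g_int
          by (simp add: set_integrable_def)
        show "\<forall>n. (\<integral>x\<in>G. g x \<partial>M) \<le> prob (B n \<inter> G)"
          unfolding cond_prob_integral[OF B G, symmetric]
        proof
          fix n
          show "(\<integral>x\<in>G. g x \<partial>M) \<le> (\<integral>x\<in>G. cond_prob (B n) x \<partial>M)"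
            by (intro set_integral_mono_AE int1 int2 eventually_mono[OF cond_B_bounds[of n]]) simp
        qed
        show "\<forall>n. prob (B n \<inter> G) \<le> (\<integral>x\<in>G. g x \<partial>M) + prob G * (1/2) ^ n"
        proof
          fix n
          have "prob (B n \<inter> G) \<le> (\<integral>x\<in>G. g x + 1 / 2 ^ n \<partial>M)"
            unfolding cond_prob_integral[OF B G, symmetric]
            by (intro set_integral_mono_AE int3 int2 eventually_mono[OF cond_B_bounds[of n]]) simp
          also have "\<dots> = (\<integral>x\<in>G. g x \<partial>M) + (\<integral>x\<in>G. 1 / 2 ^ n \<partial>M)"
            by (rule set_integral_add(2)[OF int1]) (simp add: set_integrable_def emeasure_eq_measure)
          also have "(\<integral>x\<in>G. 1 / 2 ^ n \<partial>M) = prob G * (1/2) ^ n"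
            by (simp add: set_lebesgue_integral_def power_divide)
          finally show "prob (B n \<inter> G) \<le> (\<integral>x\<in>G. g x \<partial>M) + prob G * (1/2) ^ n" .
        qed
        have "(\<lambda>n. prob G * (1/2) ^ n) \<longlonglongrightarrow> 0"
          by (rule tendsto_mult_right_zero, rule LIMSEQ_power_zero) simp
        from tendsto_add[OF tendsto_const this] show "(\<lambda>n. (\<integral>x\<in>G. g x \<partial>M) + prob G * (1/2) ^ n) \<longlonglongrightarrow> (\<integral>x\<in>G. g x \<partial>M)" by simp
      qed simp
      ultimately have "prob (\<Inter>n. B n \<inter> G) = (\<integral>x\<in>G. g x \<partial>M)" by (rule LIMSEQ_unique)
      moreover have "(\<Inter>n. B n) \<inter> G = (\<Inter>n. B n \<inter> G)" by auto
      ultimately show "prob ((\<Inter>n. B n) \<inter> G) = (\<integral>x\<in>G. g x \<partial>M)" by (simp only:)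
    qed
  qed
qed

end

section \<open>The space of square integrable vectors\<close>

definition L2inner :: "'a measure \<Rightarrow> ('a \<Rightarrow> real ^ 'm) \<Rightarrow> ('a \<Rightarrow> real ^ 'm) \<Rightarrow> real" where
  "L2inner M f g = (\<integral>\<omega>. f \<omega> \<bullet> g \<omega> \<partial>M)"

lemma square_integrable_measurable [measurable_dest]:
  "square_integrable M f \<Longrightarrow> f \<in> borel_measurable M"
  by (simp add: square_integrable_def)

lemma square_integrable_AE_cong:
  assumes "square_integrable M f" "g \<in> borel_measurable M" "AE \<omega> in M. f \<omega> = g \<omega>"
  shows "square_integrable M g"
  unfolding square_integrable_def
proof
  show "integrable M (\<lambda>\<omega>. (norm (g \<omega>))\<^sup>2)"
    by (rule integrable_cong_AE_imp[of M "\<lambda>\<omega>. (norm (f \<omega>))\<^sup>2"])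
      (use assms in \<open>auto simp: square_integrable_def\<close>)
qed fact

lemma integrable_inner_square_integrable:
  fixes f g :: "'a \<Rightarrow> real ^ 'm"
  assumes f: "square_integrable M f" and g: "square_integrable M g"
  shows "integrable M (\<lambda>\<omega>. f \<omega> \<bullet> g \<omega>)"
proof (rule Bochner_Integration.integrable_bound)
  note [measurable] = f g
  show "integrable M (\<lambda>\<omega>. (norm (f \<omega>))\<^sup>2 + (norm (g \<omega>))\<^sup>2)"
    using f g by (simp add: square_integrable_def)
  show "(\<lambda>\<omega>. f \<omega> \<bullet> g \<omega>) \<in> borel_measurable M" by measurable
  have "norm (f \<omega> \<bullet> g \<omega>) \<le> norm ((norm (f \<omega>))\<^sup>2 + (norm (g \<omega>))\<^sup>2)" for \<omega>
  proof -
    have "norm (f \<omega> \<bullet> g \<omega>) \<le> norm (f \<omega>) * norm (g \<omega>)"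
      by (simp add: Cauchy_Schwarz_ineq2)
    moreover have "2 * (norm (f \<omega>) * norm (g \<omega>)) \<le> (norm (f \<omega>))\<^sup>2 + (norm (g \<omega>))\<^sup>2"
      using sum_squares_bound[of "norm (f \<omega>)" "norm (g \<omega>)"] by (simp add: mult.assoc)
    moreover have "0 \<le> norm (f \<omega>) * norm (g \<omega>)" by simp
    ultimately show ?thesis by (smt (verit) real_norm_def)
  qed
  then show "AE \<omega> in M. norm (f \<omega> \<bullet> g \<omega>) \<le> norm ((norm (f \<omega>))\<^sup>2 + (norm (g \<omega>))\<^sup>2)" by simp
qed

lemma square_integrable_scaleR:
  "square_integrable M f \<Longrightarrow> square_integrable M (\<lambda>\<omega>. c *\<^sub>R f \<omega>)"
  by (auto simp: square_integrable_def power_mult_distrib)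

lemma square_integrable_add:
  fixes f g :: "'a \<Rightarrow> real ^ 'm"
  assumes f: "square_integrable M f" and g: "square_integrable M g"
  shows "square_integrable M (\<lambda>\<omega>. f \<omega> + g \<omega>)"
  unfolding square_integrable_def
proof
  note [measurable] = f g
  show "(\<lambda>\<omega>. f \<omega> + g \<omega>) \<in> borel_measurable M" by measurable
  have "(\<lambda>\<omega>. (norm (f \<omega> + g \<omega>))\<^sup>2) = (\<lambda>\<omega>. f \<omega> \<bullet> f \<omega> + 2 * (f \<omega> \<bullet> g \<omega>) + g \<omega> \<bullet> g \<omega>)"
    by (auto simp: power2_norm_eq_inner inner_add inner_commute)
  then show "integrable M (\<lambda>\<omega>. (norm (f \<omega> + g \<omega>))\<^sup>2)"
    using f g by (simp add: integrable_inner_square_integrable)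
qed

lemma square_integrable_diff:
  fixes f g :: "'a \<Rightarrow> real ^ 'm"
  assumes "square_integrable M f" "square_integrable M g"
  shows "square_integrable M (\<lambda>\<omega>. f \<omega> - g \<omega>)"
  using square_integrable_add[OF assms(1) square_integrable_scaleR[OF assms(2), of "-1"]] by simp

section \<open>The L^2 norm and inner product: expansion, Cauchy-Schwarz, completeness\<close>

lemma L2norm_nonneg: "0 \<le> L2norm M f"
  by (simp add: L2norm_def)

lemma L2norm_power2: "(L2norm M f)\<^sup>2 = (\<integral>\<omega>. (norm (f \<omega>))\<^sup>2 \<partial>M)"
  by (simp add: L2norm_def)

lemma L2inner_self: "L2inner M f f = (L2norm M f)\<^sup>2"
  by (simp add: L2norm_power2 L2inner_def power2_norm_eq_inner)

lemma L2inner_commute: "L2inner M f g = L2inner M g f"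
  by (simp add: L2inner_def inner_commute)

lemma L2inner_scaleR_right: "L2inner M f (\<lambda>\<omega>. c *\<^sub>R g \<omega>) = c * L2inner M f g"
  by (simp add: L2inner_def)

lemma L2inner_diff_left:
  assumes "square_integrable M f" "square_integrable M g" "square_integrable M h"
  shows "L2inner M (\<lambda>\<omega>. f \<omega> - g \<omega>) h = L2inner M f h - L2inner M g h"
  using assms by (simp add: L2inner_def inner_diff_left integrable_inner_square_integrable)

lemma L2norm_cong_AE:
  assumes "square_integrable M f" "square_integrable M g" "AE \<omega> in M. f \<omega> = g \<omega>"
  shows "L2norm M f = L2norm M g"
proof -
  note [measurable] = assms(1,2)
  have "(\<integral>\<omega>. (norm (f \<omega>))\<^sup>2 \<partial>M) = (\<integral>\<omega>. (norm (g \<omega>))\<^sup>2 \<partial>M)"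
    by (rule integral_cong_AE) (use assms in auto)
  then show ?thesis by (simp add: L2norm_def)
qed

lemma L2inner_cong_AE:
  assumes "square_integrable M f" "square_integrable M g" "square_integrable M h"
    and "AE \<omega> in M. f \<omega> = g \<omega>"
  shows "L2inner M f h = L2inner M g h"
proof -
  note [measurable] = assms(1-3)
  show ?thesis unfolding L2inner_def
    by (rule integral_cong_AE) (use assms in auto)
qed

lemma L2norm_diff_power2:
  fixes f g :: "'a \<Rightarrow> real ^ 'm"
  assumes "square_integrable M f" "square_integrable M g"
  shows "(L2norm M (\<lambda>\<omega>. f \<omega> - g \<omega>))\<^sup>2 = (L2norm M f)\<^sup>2 + (L2norm M g)\<^sup>2 - 2 * L2inner M f g"
proof -
  have "(\<lambda>\<omega>. (norm (f \<omega> - g \<omega>))\<^sup>2) = (\<lambda>\<omega>. f \<omega> \<bullet> f \<omega> + g \<omega> \<bullet> g \<omega> - 2 * (f \<omega> \<bullet> g \<omega>))"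
    by (auto simp: power2_norm_eq_inner inner_diff inner_commute)
  then have "(L2norm M (\<lambda>\<omega>. f \<omega> - g \<omega>))\<^sup>2
      = (\<integral>\<omega>. f \<omega> \<bullet> f \<omega> + g \<omega> \<bullet> g \<omega> - 2 * (f \<omega> \<bullet> g \<omega>) \<partial>M)"
    by (simp add: L2norm_power2)
  then show ?thesis
    using assms by (simp add: L2inner_self[symmetric] L2inner_def integrable_inner_square_integrable)
qed

text \<open>Discriminant argument for the nonnegative polynomial
  \<open>c - 2 * t * b + t\<^sup>2 * z\<close>. Every later use of minimality over a line of
  competitors goes through it.\<close>

lemma square_le_of_nonneg_quadratic:
  fixes b c z :: real
  assumes "\<And>t. 2 * t * b \<le> c + t\<^sup>2 * z" "0 \<le> z"
  shows "b\<^sup>2 \<le> c * z"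
proof (cases "z = 0")
  case True
  have "b = 0"
  proof (rule ccontr)
    assume "b \<noteq> 0"
    \<comment> \<open>This \<open>t\<close> makes the left side \<open>c + 1\<close>, while the
      right side is \<open>c\<close>.\<close>
    then show False using assms(1)[of "(c + 1) / (2 * b)"] True by simp
  qed
  then show ?thesis using True by simp
next
  case False
  then have "z > 0" using assms(2) by simp
  \<comment> \<open>The value \<open>b / z\<close> minimizes the quadratic and so gives the sharpest
    inequality.\<close>
  then have "2 * b\<^sup>2 / z \<le> c + b\<^sup>2 / z"
    using assms(1)[of "b / z"] by (simp add: power2_eq_square field_simps)
  then show ?thesis using \<open>z > 0\<close> by (simp add: field_simps)
qed

lemma L2_Cauchy_Schwarz:
  fixes f g :: "'a \<Rightarrow> real ^ 'm"
  assumes f: "square_integrable M f" and g: "square_integrable M g"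
  shows "\<bar>L2inner M f g\<bar> \<le> L2norm M f * L2norm M g"
proof -
  have "(L2inner M f g)\<^sup>2 \<le> (L2norm M f)\<^sup>2 * (L2norm M g)\<^sup>2"
  proof (rule square_le_of_nonneg_quadratic)
    fix t
    have "0 \<le> (L2norm M (\<lambda>\<omega>. f \<omega> - t *\<^sub>R g \<omega>))\<^sup>2" by simp
    also have "\<dots> = (L2norm M f)\<^sup>2 + t\<^sup>2 * (L2norm M g)\<^sup>2 - 2 * (t * L2inner M f g)"
      unfolding L2norm_diff_power2[OF f square_integrable_scaleR[OF g]]
        L2inner_scaleR_right
      by (simp add: L2norm_power2 power_mult_distrib)
    finally show "2 * t * L2inner M f g \<le> (L2norm M f)\<^sup>2 + t\<^sup>2 * (L2norm M g)\<^sup>2" by simp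
  qed simp
  then have "\<bar>L2inner M f g\<bar>\<^sup>2 \<le> (L2norm M f * L2norm M g)\<^sup>2"
    by (simp add: power_mult_distrib)
  then show ?thesis
    by (rule power2_le_imp_le) (simp add: L2norm_nonneg)
qed

text \<open>The cross term in the square is controlled by Cauchy-Schwarz. Both distances on the
  right are taken to \<open>g\<close>, which suits comparing two members of a sequence with one
  common later member.\<close>

lemma L2norm_triangle:
  fixes f g h :: "'a \<Rightarrow> real ^ 'm"
  assumes f: "square_integrable M f" and g: "square_integrable M g" and h: "square_integrable M h"
  shows "L2norm M (\<lambda>\<omega>. f \<omega> - h \<omega>)
    \<le> L2norm M (\<lambda>\<omega>. f \<omega> - g \<omega>) + L2norm M (\<lambda>\<omega>. h \<omega> - g \<omega>)"
proof -
  let ?u = "\<lambda>\<omega>. f \<omega> - g \<omega>" and ?v = "\<lambda>\<omega>. h \<omega> - g \<omega>"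
  have u: "square_integrable M ?u" and v: "square_integrable M ?v"
    using f g h by (simp_all add: square_integrable_diff)
  have "(L2norm M (\<lambda>\<omega>. f \<omega> - h \<omega>))\<^sup>2 = (L2norm M (\<lambda>\<omega>. ?u \<omega> - ?v \<omega>))\<^sup>2" by simp
  also have "\<dots> = (L2norm M ?u)\<^sup>2 + (L2norm M ?v)\<^sup>2 - 2 * L2inner M ?u ?v"
    by (rule L2norm_diff_power2[OF u v])
  also have "\<dots> \<le> (L2norm M ?u + L2norm M ?v)\<^sup>2"
    using L2_Cauchy_Schwarz[OF u v] by (simp add: power2_sum)
  finally show ?thesis
    by (rule power2_le_imp_le) (simp add: L2norm_nonneg)
qed

text \<open>Riesz-Fischer argument: a subsequence with geometrically small gaps converges almost
  everywhere, and Fatou's lemma shows that its pointwise limit is the L^2 limit of the whole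
  sequence.\<close>

lemma (in prob_space) L2_complete:
  fixes f :: "nat \<Rightarrow> 'a \<Rightarrow> real ^ 'm"
  assumes f: "\<And>n. square_integrable M (f n)"
    and Cauchy: "\<And>e. 0 < e \<Longrightarrow> \<exists>N. \<forall>m\<ge>N. \<forall>n\<ge>N. L2norm M (\<lambda>\<omega>. f m \<omega> - f n \<omega>) \<le> e"
  obtains g where "square_integrable M g" "(\<lambda>n. L2norm M (\<lambda>\<omega>. f n \<omega> - g \<omega>)) \<longlonglongrightarrow> 0"
proof -
  note [measurable] = f
  have "\<exists>r. \<forall>k. (\<forall>m\<ge>r k. \<forall>n\<ge>r k. L2norm M (\<lambda>\<omega>. f m \<omega> - f n \<omega>) \<le> (1/2) ^ k) \<and> r k \<le> (r (Suc k) :: nat)"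
  proof (rule dependent_nat_choice)
    show "\<exists>N. \<forall>m\<ge>N. \<forall>n\<ge>N. L2norm M (\<lambda>\<omega>. f m \<omega> - f n \<omega>) \<le> (1/2) ^ 0"
      by (rule Cauchy) simp
    fix x k
    obtain N where "\<forall>m\<ge>N. \<forall>n\<ge>N. L2norm M (\<lambda>\<omega>. f m \<omega> - f n \<omega>) \<le> (1/2) ^ Suc k"
      using Cauchy[of "(1/2) ^ Suc k"] by auto
    then show "\<exists>y. (\<forall>m\<ge>y. \<forall>n\<ge>y. L2norm M (\<lambda>\<omega>. f m \<omega> - f n \<omega>) \<le> (1/2) ^ Suc k) \<and> x \<le> y"
      by (intro exI[of _ "max N x"]) auto
  qed
  then obtain r where r: "\<And>k m n. r k \<le> m \<Longrightarrow> r k \<le> n \<Longrightarrow> L2norm M (\<lambda>\<omega>. f m \<omega> - f n \<omega>) \<le> (1/2) ^ k"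
    and r_Suc: "\<And>k. r k \<le> r (Suc k)" by blast
  have r_mono: "r k \<le> r l" if "k \<le> l" for k l
    using that by (rule lift_Suc_mono_le[of r, OF r_Suc])
  have square: "(\<integral>\<omega>. (norm (f m \<omega> - f n \<omega>))\<^sup>2 \<partial>M) \<le> ((1/2) ^ k)\<^sup>2" if "r k \<le> m" "r k \<le> n" for k m n
    unfolding L2norm_power2[symmetric]
    by (rule power_mono[OF r[OF that] L2norm_nonneg])
  have sq_int: "integrable M (\<lambda>\<omega>. (norm (f m \<omega> - f n \<omega>))\<^sup>2)" for m n
    using square_integrable_diff[OF f f] by (simp add: square_integrable_def)
  define h where "h k \<omega> = f (r (Suc k)) \<omega> - f (r k) \<omega>" for k \<omega>
  have h_meas [measurable]: "h k \<in> borel_measurable M" for k unfolding h_def by measurable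
  \<comment> \<open>In a probability space the first moment is controlled by the second. The weights
    \<open>2 ^ k\<close> and \<open>(1/2) ^ k\<close> come from expanding
    \<open>(2 ^ k * norm (h k \<omega>) - 1)\<^sup>2\<close>; they balance a second moment of size
    \<open>((1/2) ^ k)\<^sup>2\<close> so that the first moments are summable.\<close>
  have h_int: "(\<integral>\<^sup>+\<omega>. ennreal (norm (h k \<omega>)) \<partial>M) \<le> ennreal (2 * (1/2) ^ k)" for k
  proof -
    have int: "integrable M (\<lambda>\<omega>. 2 ^ k * (norm (h k \<omega>))\<^sup>2 + (1/2) ^ k)"
      unfolding h_def using sq_int by simp
    have "norm (h k \<omega>) \<le> 2 ^ k * (norm (h k \<omega>))\<^sup>2 + (1/2) ^ k" for \<omega>
    proof -
      have "0 \<le> (2 ^ k * norm (h k \<omega>) - 1)\<^sup>2" by simp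
      then have "2 * (2 ^ k * norm (h k \<omega>)) \<le> (2 ^ k)\<^sup>2 * (norm (h k \<omega>))\<^sup>2 + 1"
        by (simp add: power2_diff power_mult_distrib)
      moreover have "0 \<le> 2 ^ k * norm (h k \<omega>)" by simp
      ultimately have "2 ^ k * norm (h k \<omega>) \<le> (2 ^ k)\<^sup>2 * (norm (h k \<omega>))\<^sup>2 + 1" by linarith
      then have "2 ^ k * norm (h k \<omega>) \<le> 2 ^ k * (2 ^ k * (norm (h k \<omega>))\<^sup>2 + (1/2) ^ k)"
        by (simp add: power2_eq_square algebra_simps power_one_over)
      then show ?thesis by simp
    qed
    then have "(\<integral>\<^sup>+\<omega>. ennreal (norm (h k \<omega>)) \<partial>M)
      \<le> (\<integral>\<^sup>+\<omega>. ennreal (2 ^ k * (norm (h k \<omega>))\<^sup>2 + (1/2) ^ k) \<partial>M)"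
      by (intro nn_integral_mono ennreal_leI)
    also have "\<dots> = ennreal (\<integral>\<omega>. 2 ^ k * (norm (h k \<omega>))\<^sup>2 + (1/2) ^ k \<partial>M)"
      by (rule nn_integral_eq_integral[OF int]) simp
    also have "(\<integral>\<omega>. 2 ^ k * (norm (h k \<omega>))\<^sup>2 + (1/2) ^ k \<partial>M)
        = 2 ^ k * (\<integral>\<omega>. (norm (h k \<omega>))\<^sup>2 \<partial>M) + (1/2) ^ k"
      unfolding h_def using sq_int by (simp add: prob_space)
    also have "\<dots> \<le> 2 ^ k * ((1/2) ^ k)\<^sup>2 + (1/2) ^ k"
      unfolding h_def using square[of k "r (Suc k)" "r k"] r_Suc by simp
    also have "\<dots> = 2 * (1/2) ^ k"
      by (simp add: power2_eq_square power_one_over)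
    finally show ?thesis by (simp add: ennreal_leI)
  qed
  have "AE \<omega> in M. summable (\<lambda>k. norm (h k \<omega>))"
  proof -
    have "(\<integral>\<^sup>+\<omega>. (\<Sum>k. ennreal (norm (h k \<omega>))) \<partial>M) = (\<Sum>k. \<integral>\<^sup>+\<omega>. ennreal (norm (h k \<omega>)) \<partial>M)"
      by (rule nn_integral_suminf) measurable
    also have "\<dots> \<le> (\<Sum>k. ennreal (2 * (1/2) ^ k))"
      by (rule suminf_le[OF h_int]) auto
    also have "\<dots> = ennreal (\<Sum>k. 2 * (1/2) ^ k)"
      by (rule suminf_ennreal2) (auto intro!: summable_mult summable_geometric)
    finally have "(\<integral>\<^sup>+\<omega>. (\<Sum>k. ennreal (norm (h k \<omega>))) \<partial>M) \<noteq> \<infinity>"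
      by (auto simp: top_unique)
    then have "AE \<omega> in M. (\<Sum>k. ennreal (norm (h k \<omega>))) \<noteq> \<infinity>"
      by (intro nn_integral_PInf_AE) measurable
    then show ?thesis
      by eventually_elim (auto intro!: summable_suminf_not_top)
  qed
  then have conv: "AE \<omega> in M. convergent (\<lambda>k. f (r k) \<omega>)"
  proof eventually_elim
    case (elim \<omega>)
    have "(\<lambda>k. f (r 0) \<omega> + (\<Sum>j<k. h j \<omega>)) = (\<lambda>k. f (r k) \<omega>)"
      unfolding h_def by (simp add: sum_lessThan_telescope[of "\<lambda>j. f (r j) \<omega>"])
    moreover have "convergent (\<lambda>k. f (r 0) \<omega> + (\<Sum>j<k. h j \<omega>))"
      using summable_norm_cancel[OF elim]
      by (intro convergent_add) (auto simp: convergent_const summable_iff_convergent)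
    ultimately show ?case by simp
  qed
  \<comment> \<open>Where the subsequence diverges, \<open>lim\<close> has an unspecified value; by
    \<open>conv\<close> this happens only on a null set.\<close>
  define g where "g \<omega> = lim (\<lambda>k. f (r k) \<omega>)" for \<omega>
  have g_meas [measurable]: "g \<in> borel_measurable M"
    unfolding g_def by measurable
  have Fatou: "(\<integral>\<^sup>+\<omega>. ennreal ((norm (f n \<omega> - g \<omega>))\<^sup>2) \<partial>M) \<le> ennreal (((1/2) ^ k)\<^sup>2)"
    if "r k \<le> n" for n k
  proof -
    have "(\<integral>\<^sup>+\<omega>. ennreal ((norm (f n \<omega> - g \<omega>))\<^sup>2) \<partial>M)
      = (\<integral>\<^sup>+\<omega>. liminf (\<lambda>l. ennreal ((norm (f n \<omega> - f (r l) \<omega>))\<^sup>2)) \<partial>M)"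
    proof (rule nn_integral_cong_AE)
      show "AE \<omega> in M. ennreal ((norm (f n \<omega> - g \<omega>))\<^sup>2)
        = liminf (\<lambda>l. ennreal ((norm (f n \<omega> - f (r l) \<omega>))\<^sup>2))"
        using conv
      proof eventually_elim
        case (elim \<omega>)
        then have "(\<lambda>l. f (r l) \<omega>) \<longlonglongrightarrow> g \<omega>"
          by (simp add: g_def convergent_LIMSEQ_iff)
        then have "(\<lambda>l. ennreal ((norm (f n \<omega> - f (r l) \<omega>))\<^sup>2)) \<longlonglongrightarrow> ennreal ((norm (f n \<omega> - g \<omega>))\<^sup>2)"
          by (intro tendsto_intros)
        then show ?case by (rule lim_imp_Liminf[OF sequentially_bot, symmetric])
      qed
    qed
    also have "\<dots> \<le> liminf (\<lambda>l. \<integral>\<^sup>+\<omega>. ennreal ((norm (f n \<omega> - f (r l) \<omega>))\<^sup>2) \<partial>M)"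
      by (rule nn_integral_liminf) measurable
    also have "\<dots> \<le> liminf (\<lambda>l::nat. ennreal (((1/2) ^ k)\<^sup>2))"
    proof (rule Liminf_mono, rule eventually_sequentiallyI[of k])
      fix l assume "k \<le> l"
      have "(\<integral>\<^sup>+\<omega>. ennreal ((norm (f n \<omega> - f (r l) \<omega>))\<^sup>2) \<partial>M)
        = ennreal (\<integral>\<omega>. (norm (f n \<omega> - f (r l) \<omega>))\<^sup>2 \<partial>M)"
        by (rule nn_integral_eq_integral[OF sq_int]) simp
      also have "\<dots> \<le> ennreal (((1/2) ^ k)\<^sup>2)"
        by (rule ennreal_leI[OF square[OF that r_mono[OF \<open>k \<le> l\<close>]]])
      finally show "(\<integral>\<^sup>+\<omega>. ennreal ((norm (f n \<omega> - f (r l) \<omega>))\<^sup>2) \<partial>M) \<le> ennreal (((1/2) ^ k)\<^sup>2)" .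
    qed
    also have "\<dots> = ennreal (((1/2) ^ k)\<^sup>2)" by (rule Liminf_const) simp
    finally show ?thesis .
  qed
  have diff: "square_integrable M (\<lambda>\<omega>. f n \<omega> - g \<omega>)" if "r k \<le> n" for n k
    unfolding square_integrable_def
    using order.strict_trans1[OF Fatou[OF that], of \<infinity>] by (auto intro!: integrableI_bounded)
  have bound: "L2norm M (\<lambda>\<omega>. f n \<omega> - g \<omega>) \<le> (1/2) ^ k" if "r k \<le> n" for n k
  proof -
    have "ennreal (\<integral>\<omega>. (norm (f n \<omega> - g \<omega>))\<^sup>2 \<partial>M) = (\<integral>\<^sup>+\<omega>. ennreal ((norm (f n \<omega> - g \<omega>))\<^sup>2) \<partial>M)"
      by (rule nn_integral_eq_integral[symmetric])
        (use diff[OF that] in \<open>auto simp: square_integrable_def\<close>)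
    also note Fatou[OF that]
    finally have "(L2norm M (\<lambda>\<omega>. f n \<omega> - g \<omega>))\<^sup>2 \<le> ((1/2) ^ k)\<^sup>2"
      by (simp add: L2norm_power2)
    then show ?thesis by (rule power2_le_imp_le) simp
  qed
  show thesis
  proof
    \<comment> \<open>Fatou controls only differences \<open>f n - g\<close>, so \<open>g\<close> is
      recovered as \<open>f (r 0)\<close> minus such a difference.\<close>
    show "square_integrable M g"
      using square_integrable_diff[OF f[of "r 0"] diff[of 0 "r 0"]] by simp
    show "(\<lambda>n. L2norm M (\<lambda>\<omega>. f n \<omega> - g \<omega>)) \<longlonglongrightarrow> 0"
    proof (rule LIMSEQ_I)
      fix e :: real assume "0 < e"
      then obtain k where k: "(1/2) ^ k < e" using real_arch_pow_inv[of e "1/2"] by auto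
      show "\<exists>N. \<forall>n\<ge>N. norm (L2norm M (\<lambda>\<omega>. f n \<omega> - g \<omega>) - 0) < e"
        using bound[of k] k by (intro exI[of _ "r k"]) (auto simp: L2norm_nonneg intro: le_less_trans)
    qed
  qed
qed

section \<open>Independence of a sub-sigma-algebra\<close>

context prob_subalgebra
begin

lemma indep_of_subalgebra_iff:
  "indep_of_subalgebra M A Z \<longleftrightarrow> Z \<in> borel_measurable M \<and>
    (\<forall>B\<in>sets borel. \<forall>G\<in>sets A. prob (Z -` B \<inter> space M \<inter> G) = prob (Z -` B \<inter> space M) * prob G)"
  unfolding indep_of_subalgebra_def indep_sets2_eq
  using subalgebra_sets by (auto simp: measurable_sets)

text \<open>Preimages under the composite are preimages under \<open>Z\<close> of other Borel sets.
  Hence multiples, translates by constants and coordinates of \<open>Z\<close> stay independent of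
  \<open>A\<close>. Sums of two independent variables in general do not, so the class is a cone and
  not a linear space.\<close>

lemma indep_of_subalgebra_compose:
  fixes h :: "'b::topological_space \<Rightarrow> 'c::topological_space"
  assumes Z: "indep_of_subalgebra M A Z" and h: "h \<in> borel_measurable borel"
  shows "indep_of_subalgebra M A (\<lambda>\<omega>. h (Z \<omega>))"
  unfolding indep_of_subalgebra_iff
proof (intro conjI ballI)
  have Zm [measurable]: "Z \<in> borel_measurable M" using Z by (simp add: indep_of_subalgebra_iff)
  show "(\<lambda>\<omega>. h (Z \<omega>)) \<in> borel_measurable M" using h by measurable
  fix B :: "'c set" and G assume "B \<in> sets borel" "G \<in> sets A"
  moreover have "(\<lambda>\<omega>. h (Z \<omega>)) -` B = Z -` (h -` B)" by auto
  moreover have "h -` B \<in> sets borel" using measurable_sets[OF h \<open>B \<in> sets borel\<close>] by simp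
  ultimately show "prob ((\<lambda>\<omega>. h (Z \<omega>)) -` B \<inter> space M \<inter> G)
      = prob ((\<lambda>\<omega>. h (Z \<omega>)) -` B \<inter> space M) * prob G"
    using Z by (simp add: indep_of_subalgebra_iff)
qed

text \<open>Integrating the constant conditional probability over \<open>G\<close> gives
  \<open>prob (B \<inter> G) = c * prob G\<close>, and the whole space as \<open>G\<close>
  identifies \<open>c\<close> with \<open>prob B\<close>. This supplies the test variables for the
  orthogonality argument.\<close>

lemma indep_of_subalgebra_indicator:
  fixes v :: "'b::real_normed_vector"
  assumes B: "B \<in> events" and const: "AE x in M. cond_prob B x = c"
  shows "indep_of_subalgebra M A (\<lambda>\<omega>. indicator B \<omega> *\<^sub>R v)"
proof -
  have c: "prob (B \<inter> G) = c * prob G" if G: "G \<in> sets A" for G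
  proof -
    have [measurable]: "G \<in> events" using G by (rule subalgebra_sets)
    have "prob (B \<inter> G) = (\<integral>x\<in>G. cond_prob B x \<partial>M)"
      using cond_prob_integral[OF B G] by simp
    also have "\<dots> = (\<integral>x\<in>G. c \<partial>M)"
      unfolding set_lebesgue_integral_def
      by (rule integral_cong_AE) (use const integrable_cond_prob[OF B] in auto)
    finally show ?thesis by (simp add: set_lebesgue_integral_def mult.commute)
  qed
  have "prob B = c"
    using c[of "space M"] sets.top[of A] B by (simp add: space_subalgebra prob_space)
  then have indep: "prob (B \<inter> G) = prob B * prob G" if "G \<in> sets A" for G using c[OF that] by simp
  have "indep_of_subalgebra M A (indicator B :: 'a \<Rightarrow> real)"
    unfolding indep_of_subalgebra_iff
  proof (intro conjI ballI)
    fix E :: "real set" and G assume G: "G \<in> sets A"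
    let ?P = "indicator B -` E \<inter> space M"
    have GM: "G \<in> events" using G by (rule subalgebra_sets)
    have sub: "G \<subseteq> space M" "B \<subseteq> space M" using GM B sets.sets_into_space by auto
    have "prob ((space M - B) \<inter> G) = prob (G - B \<inter> G)"
      using sub by (intro arg_cong[where f=prob]) auto
    also have "\<dots> = prob G - prob (B \<inter> G)"
      by (rule finite_measure_Diff) (use B GM in auto)
    finally have compl: "prob ((space M - B) \<inter> G) = prob (space M - B) * prob G"
      by (simp add: indep[OF G] prob_compl[OF B] algebra_simps)
    \<comment> \<open>An indicator takes only the values 0 and 1, so its preimages are just four
      events, each independent of \<open>G\<close>.\<close>
    have "?P = (if 1 \<in> E then B else {}) \<union> (if 0 \<in> E then space M - B else {})"
    proof (rule set_eqI)
      fix x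
      show "x \<in> ?P \<longleftrightarrow> x \<in> (if 1 \<in> E then B else {}) \<union> (if 0 \<in> E then space M - B else {})"
        using sub by (cases "x \<in> B") auto
    qed
    then have "?P = {} \<or> ?P = B \<or> ?P = space M - B \<or> ?P = space M"
      using sub by (auto split: if_splits)
    moreover have "prob (space M \<inter> G) = prob (space M) * prob G"
      using sub by (simp add: Int_absorb1 prob_space)
    ultimately show "prob (?P \<inter> G) = prob ?P * prob G"
      using indep[OF G] compl by (elim disjE) (simp_all only: Int_empty_left measure_empty)
  qed (use B in simp)
  then show ?thesis
    by (rule indep_of_subalgebra_compose)
      (intro borel_measurable_continuous_onI continuous_intros)
qed

text \<open>This is the product rule for expectations applied to \<open>Z\<close> and the indicator
  of \<open>G\<close>. The two families of preimages are closed under intersection, so their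
  independence passes to the generated \<sigma>-algebras.\<close>

lemma set_integral_indep_of_subalgebra:
  fixes Z :: "'a \<Rightarrow> real"
  assumes indep: "indep_of_subalgebra M A Z" and int: "integrable M Z" and G: "G \<in> sets A"
  shows "(\<integral>x\<in>G. Z x \<partial>M) = prob G * expectation Z"
proof -
  have GM [measurable]: "G \<in> events" using G by (rule subalgebra_sets)
  have Z [measurable]: "Z \<in> borel_measurable M" using int by simp
  let ?PZ = "{Z -` B \<inter> space M | B. B \<in> sets borel}"
  let ?PG = "{indicator G -` B \<inter> space M | B. B \<in> sets (borel :: real measure)}"
  have GA: "(indicator G :: 'a \<Rightarrow> real) \<in> borel_measurable A" using G by simp
  have "?PG \<subseteq> sets A"
    using measurable_sets[OF GA] by (auto simp: space_subalgebra)
  moreover have "indep_set ?PZ (sets A)" using indep by (simp add: indep_of_subalgebra_def)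
  ultimately have ind: "indep_set ?PZ ?PG" unfolding indep_sets2_eq by blast
  have stable: "Int_stable {f -` B \<inter> space M | B. B \<in> sets (borel :: real measure)}" for f
  proof (rule Int_stableI)
    fix a b assume "a \<in> {f -` B \<inter> space M | B. B \<in> sets (borel :: real measure)}"
      "b \<in> {f -` B \<inter> space M | B. B \<in> sets (borel :: real measure)}"
    then obtain B C where "B \<in> sets borel" "C \<in> sets borel"
      "a = f -` B \<inter> space M" "b = f -` C \<inter> space M" by blast
    then show "a \<inter> b \<in> {f -` B \<inter> space M | B. B \<in> sets (borel :: real measure)}"
      by (intro CollectI exI[of _ "B \<inter> C"]) auto
  qed
  have "indep_var borel Z borel (indicator G)"
    unfolding indep_var_eq using indep_set_sigma_sets[OF ind stable stable] by auto
  then have "expectation (\<lambda>x. Z x * indicator G x) = expectation Z * expectation (indicator G)"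
    using int by (intro indep_var_lebesgue_integral integrable_indicator_event) auto
  then show ?thesis by (simp add: set_lebesgue_integral_def mult.commute)
qed

text \<open>The set where the conditional probability vanishes belongs to \<open>A\<close>, and
  \<open>x\<close> is almost surely nonpositive on it. The integral of \<open>x\<close> over this
  set is zero, so \<open>x\<close> vanishes there.\<close>

lemma AE_zero_on_cond_prob_pos_zero:
  fixes x :: "'a \<Rightarrow> real"
  assumes x: "integrable M x"
    and zero: "\<And>G. G \<in> sets A \<Longrightarrow> (\<integral>\<omega>\<in>G. x \<omega> \<partial>M) = 0"
  shows "AE \<omega> in M. cond_prob {\<omega> \<in> space M. 0 < x \<omega>} \<omega> = 0 \<longrightarrow> x \<omega> = 0"
proof -
  have [measurable]: "x \<in> borel_measurable M" using x by simp
  let ?P = "{\<omega> \<in> space M. 0 < x \<omega>}"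
  have P [measurable]: "?P \<in> events" by measurable
  define G where "G = {\<omega> \<in> space A. cond_prob ?P \<omega> = 0}"
  have G: "G \<in> sets A" unfolding G_def by measurable
  have [measurable]: "G \<in> events" using G by (rule subalgebra_sets)
  have "prob (?P \<inter> G) = (\<integral>\<omega>\<in>G. cond_prob ?P \<omega> \<partial>M)"
    using cond_prob_integral[OF P G] by simp
  also have "\<dots> = (\<integral>\<omega>\<in>G. 0 \<partial>M)"
    by (rule set_lebesgue_integral_cong) (auto simp: G_def subalgebra_sets[OF G, unfolded G_def])
  finally have "prob (?P \<inter> G) = 0" by simp
  then have "AE \<omega> in M. \<omega> \<notin> ?P \<inter> G" by (subst (asm) prob_eq_0) auto
  then have nonpos: "AE \<omega> in M. 0 \<le> - (indicator G \<omega> * x \<omega>)"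
    using AE_space by eventually_elim (auto simp: indicator_def not_less)
  have int: "integrable M (\<lambda>\<omega>. - (indicator G \<omega> * x \<omega>))"
    using integrable_mult_indicator[OF \<open>G \<in> events\<close> x] by simp
  have "(\<integral>\<omega>. - (indicator G \<omega> * x \<omega>) \<partial>M) = 0"
    using zero[OF G] by (simp add: set_lebesgue_integral_def)
  then have "AE \<omega> in M. - (indicator G \<omega> * x \<omega>) = 0"
    using integral_nonneg_eq_0_iff_AE[OF int nonpos] by simp
  then show ?thesis
    using AE_space by eventually_elim (auto simp: G_def indicator_def space_subalgebra split: if_splits)
qed

text \<open>If \<open>x\<close> is not null, then the events \<open>{x > 0}\<close> and \<open>{x < 0}\<close> contain \<open>B\<^sub>1\<close> and \<open>B\<^sub>2\<close> of equal,
  nonzero conditional probability \<open>g \<le> 1/2\<close>. Completing both by the same set \<open>C\<close> of conditional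
  probability \<open>1/2 - g\<close> gives two events independent of \<open>A\<close> on which \<open>x\<close> has different integrals.\<close>

lemma AE_zero_of_orthogonal_indep:
  assumes atomless: "conditionally_atomless M A"
    and x: "integrable M x"
    and zero: "\<And>G. G \<in> sets A \<Longrightarrow> (\<integral>\<omega>\<in>G. x \<omega> \<partial>M) = 0"
    and orth: "\<And>B. B \<in> events \<Longrightarrow> AE \<omega> in M. cond_prob B \<omega> = 1/2 \<Longrightarrow> (\<integral>\<omega>\<in>B. x \<omega> \<partial>M) = 0"
  shows "AE \<omega> in M. x \<omega> = (0::real)"
proof -
  have x_meas [measurable]: "x \<in> borel_measurable M" using x by simp
  let ?P = "{\<omega> \<in> space M. 0 < x \<omega>}" and ?Q = "{\<omega> \<in> space M. 0 < - x \<omega>}"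
  have P [measurable]: "?P \<in> events" and Q [measurable]: "?Q \<in> events" by measurable
  \<comment> \<open>The two conditional probabilities add up to at most 1, so the smaller one is at
    most \<open>1/2\<close>.\<close>
  define g where "g \<omega> = min (cond_prob ?P \<omega>) (cond_prob ?Q \<omega>)" for \<omega>
  have g [measurable]: "g \<in> borel_measurable A" unfolding g_def by measurable
  have PQ: "AE \<omega> in M. cond_prob (?P \<union> ?Q) \<omega> = cond_prob ?P \<omega> + cond_prob ?Q \<omega>"
    by (rule cond_prob_disjoint_Un) auto
  have g_half: "AE \<omega> in M. 0 \<le> g \<omega> \<and> g \<omega> \<le> 1/2"
    using PQ cond_prob_le_1[of "?P \<union> ?Q"] cond_prob_nonneg[OF P] cond_prob_nonneg[OF Q]
    by (auto simp: g_def)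
  obtain B1 where B1 [measurable]: "B1 \<in> events" and B1_sub: "B1 \<subseteq> ?P"
    and B1_prob: "AE \<omega> in M. cond_prob B1 \<omega> = g \<omega>"
    by (rule exists_subset_cond_prob_eq[OF atomless P g]) (use g_half in \<open>auto simp: g_def\<close>)
  obtain B2 where B2 [measurable]: "B2 \<in> events" and B2_sub: "B2 \<subseteq> ?Q"
    and B2_prob: "AE \<omega> in M. cond_prob B2 \<omega> = g \<omega>"
    by (rule exists_subset_cond_prob_eq[OF atomless Q g]) (use g_half in \<open>auto simp: g_def\<close>)
  have "B1 \<inter> B2 = {}" using B1_sub B2_sub by force
  then have "AE \<omega> in M. cond_prob (B1 \<union> B2) \<omega> = cond_prob B1 \<omega> + cond_prob B2 \<omega>"
    by (intro cond_prob_disjoint_Un) auto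
  moreover have "AE \<omega> in M. cond_prob (space M - (B1 \<union> B2)) \<omega> = 1 - cond_prob (B1 \<union> B2) \<omega>"
    by (rule cond_prob_compl) auto
  ultimately have rest: "AE \<omega> in M. cond_prob (space M - (B1 \<union> B2)) \<omega> = 1 - 2 * g \<omega>"
    using B1_prob B2_prob by auto
  \<comment> \<open>There is room for \<open>C\<close> because
    \<open>1/2 - g \<omega> \<le> 1 - 2 * g \<omega>\<close> whenever
    \<open>g \<omega> \<le> 1/2\<close>.\<close>
  obtain C where C [measurable]: "C \<in> events" and C_sub: "C \<subseteq> space M - (B1 \<union> B2)"
    and C_prob: "AE \<omega> in M. cond_prob C \<omega> = 1/2 - g \<omega>"
    by (rule exists_subset_cond_prob_eq[OF atomless, of "space M - (B1 \<union> B2)" "\<lambda>\<omega>. 1/2 - g \<omega>"])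
      (use g_half rest in auto)
  have set_int: "set_integrable M B x" if "B \<in> events" for B
    using integrable_mult_indicator[OF that x] by (simp add: set_integrable_def)
  have split: "(\<integral>\<omega>\<in>B. x \<omega> \<partial>M) + (\<integral>\<omega>\<in>C. x \<omega> \<partial>M) = 0"
    if B: "B \<in> events" "B \<inter> C = {}" "AE \<omega> in M. cond_prob B \<omega> = g \<omega>" for B
  proof -
    have "AE \<omega> in M. cond_prob (B \<union> C) \<omega> = cond_prob B \<omega> + cond_prob C \<omega>"
      by (rule cond_prob_disjoint_Un) (use that C in auto)
    then have "AE \<omega> in M. cond_prob (B \<union> C) \<omega> = 1/2" using B(3) C_prob by auto
    then have "(\<integral>\<omega>\<in>B \<union> C. x \<omega> \<partial>M) = 0" using B(1) C by (intro orth) auto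
    moreover have "(\<integral>\<omega>\<in>B \<union> C. x \<omega> \<partial>M) = (\<integral>\<omega>\<in>B. x \<omega> \<partial>M) + (\<integral>\<omega>\<in>C. x \<omega> \<partial>M)"
      by (rule set_integral_Un) (use B C set_int in auto)
    ultimately show ?thesis by simp
  qed
  have nonneg: "AE \<omega> in M. 0 \<le> indicator B1 \<omega> * x \<omega>"
    by (rule AE_I2) (use B1_sub in \<open>auto simp: indicator_def\<close>)
  have "0 \<le> (\<integral>\<omega>\<in>B1. x \<omega> \<partial>M)" unfolding set_lebesgue_integral_def
    using integral_nonneg_AE[OF nonneg] by simp
  moreover have "0 \<le> (\<integral>\<omega>. - (indicator B2 \<omega> * x \<omega>) \<partial>M)"
    by (intro integral_nonneg_AE AE_I2) (use B2_sub in \<open>auto simp: indicator_def\<close>)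
  then have "(\<integral>\<omega>\<in>B2. x \<omega> \<partial>M) \<le> 0" by (simp add: set_lebesgue_integral_def)
  moreover have "(\<integral>\<omega>\<in>B1. x \<omega> \<partial>M) + (\<integral>\<omega>\<in>C. x \<omega> \<partial>M) = 0"
    by (rule split[OF B1 _ B1_prob]) (use C_sub in auto)
  moreover have "(\<integral>\<omega>\<in>B2. x \<omega> \<partial>M) + (\<integral>\<omega>\<in>C. x \<omega> \<partial>M) = 0"
    by (rule split[OF B2 _ B2_prob]) (use C_sub in auto)
  \<comment> \<open>The integrals over \<open>B1\<close> and \<open>B2\<close> both equal minus the
    integral over \<open>C\<close>, yet one is nonnegative and the other nonpositive, so they are
    zero.\<close>
  ultimately have "(\<integral>\<omega>. indicator B1 \<omega> * x \<omega> \<partial>M) = 0"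
    by (simp add: set_lebesgue_integral_def)
  moreover have "integrable M (\<lambda>\<omega>. indicator B1 \<omega> * x \<omega>)"
    using set_int[OF B1] by (simp add: set_integrable_def)
  ultimately have "AE \<omega> in M. indicator B1 \<omega> * x \<omega> = 0"
    using integral_nonneg_eq_0_iff_AE nonneg by blast
  then have "AE \<omega> in M. \<omega> \<notin> B1"
    by eventually_elim (use B1_sub in \<open>auto simp: indicator_def split: if_splits\<close>)
  then have "prob B1 = 0" by (subst prob_eq_0) auto
  moreover have "prob (B1 \<inter> space M) = (\<integral>\<omega>\<in>space M. cond_prob B1 \<omega> \<partial>M)"
    using cond_prob_integral[OF B1, of "space M"] sets.top[of A] by (simp add: space_subalgebra)
  ultimately have "(\<integral>\<omega>. cond_prob B1 \<omega> \<partial>M) = 0"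
    by (simp add: set_integral_space integrable_cond_prob)
  then have "AE \<omega> in M. cond_prob B1 \<omega> = 0"
    using integral_nonneg_eq_0_iff_AE[OF integrable_cond_prob cond_prob_nonneg] by simp
  \<comment> \<open>The minimum \<open>g\<close> is null, so at almost every point one of the two
    signs has conditional probability zero. The preceding lemma, applied to \<open>x\<close> and to
    \<open>- x\<close>, then handles both cases.\<close>
  then have "AE \<omega> in M. cond_prob ?P \<omega> = 0 \<or> cond_prob ?Q \<omega> = 0"
    using B1_prob by eventually_elim (auto simp: g_def min_def split: if_splits)
  moreover have "AE \<omega> in M. cond_prob ?P \<omega> = 0 \<longrightarrow> x \<omega> = 0"
    by (rule AE_zero_on_cond_prob_pos_zero[OF x zero])
  moreover have "AE \<omega> in M. cond_prob ?Q \<omega> = 0 \<longrightarrow> - x \<omega> = 0"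
    by (rule AE_zero_on_cond_prob_pos_zero)
      (use x zero in \<open>auto simp: set_lebesgue_integral_def\<close>)
  ultimately show ?thesis by eventually_elim auto
qed

end

section \<open>Greedy approximation\<close>

text \<open>Otherwise the squares of the partial sums of \<open>a\<close> would grow at least linearly, whereas
  the Cauchy-Schwarz inequality makes them sublinear.\<close>

lemma square_summable_mult_sum_small:
  fixes a :: "nat \<Rightarrow> real"
  assumes nonneg: "\<And>n. 0 \<le> a n" and summable: "summable (\<lambda>n. (a n)\<^sup>2)" and e: "0 < e"
  shows "\<exists>m\<ge>N. a m * (\<Sum>j\<le>m. a j) < e"
proof (rule ccontr)
  assume "\<not> ?thesis"
  then have large: "e \<le> a m * (\<Sum>j\<le>m. a j)" if "N \<le> m" for m using that by force
  define S where "S m = (\<Sum>j\<le>m. a j)" for m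
  have S_nonneg: "0 \<le> S m" for m unfolding S_def by (simp add: sum_nonneg nonneg)
  \<comment> \<open>The threshold \<open>e / 4\<close> is chosen so that, after doubling and
    Cauchy-Schwarz, the squared partial sums grow at rate at most \<open>e / 2\<close>, half of the
    rate in \<open>lower\<close>.\<close>
  obtain K0 where K0: "\<And>m n. K0 \<le> m \<Longrightarrow> norm (\<Sum>j=m..<n. (a j)\<^sup>2) < e / 4"
    using summable e unfolding summable_Cauchy by (metis zero_less_divide_iff zero_less_numeral)
  define K where "K = max K0 N"
  \<comment> \<open>The difference of consecutive squares is \<open>a m * S m\<close> plus a
    nonnegative term, and \<open>large\<close> bounds it below by \<open>e\<close>.\<close>
  have lower: "(S K)\<^sup>2 + e * n \<le> (S (K + n))\<^sup>2" for n
  proof (induction n)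
    case (Suc n)
    have step: "S (K + Suc n) = S (K + n) + a (K + Suc n)" by (simp add: S_def)
    have "(S (K + Suc n))\<^sup>2 = (S (K + n))\<^sup>2 + a (K + Suc n) * S (K + Suc n) + a (K + Suc n) * S (K + n)"
      unfolding step by (simp add: power2_eq_square algebra_simps)
    moreover have "e \<le> a (K + Suc n) * S (K + Suc n)"
      unfolding S_def by (rule large) (simp add: K_def)
    moreover have "0 \<le> a (K + Suc n) * S (K + n)" by (intro mult_nonneg_nonneg nonneg S_nonneg)
    ultimately show ?case using Suc by (simp add: algebra_simps)
  qed simp
  have upper: "(S (K + n))\<^sup>2 \<le> 2 * (S K)\<^sup>2 + e * n / 2" for n
  proof -
    let ?T = "\<Sum>j=Suc K..<Suc K + n. a j"
    have "S (K + n) = S K + ?T"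
      by (induction n) (simp_all add: S_def)
    then have "(S (K + n))\<^sup>2 \<le> 2 * (S K)\<^sup>2 + 2 * ?T\<^sup>2"
      using sum_squares_bound[of "S K" ?T] by (simp add: power2_sum)
    moreover have "?T\<^sup>2 \<le> (\<Sum>j=Suc K..<Suc K + n. (a j)\<^sup>2) * n"
      using sum_squared_le_sum_of_squares[of a "{Suc K..<Suc K + n}"] by simp
    moreover have "(\<Sum>j=Suc K..<Suc K + n. (a j)\<^sup>2) \<le> e / 4"
      using K0[of "Suc K" "Suc K + n"] unfolding real_norm_def K_def by linarith
    then have "(\<Sum>j=Suc K..<Suc K + n. (a j)\<^sup>2) * n \<le> e / 4 * n"
      by (rule mult_right_mono) simp
    ultimately show ?thesis by simp
  qed
  \<comment> \<open>Together \<open>lower\<close> and \<open>upper\<close> force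
    \<open>e * n \<le> 2 * (S K)\<^sup>2\<close>, which fails for this \<open>n\<close>.\<close>
  obtain n :: nat where "2 * (S K)\<^sup>2 / e < n" using reals_Archimedean2 by blast
  then have "2 * (S K)\<^sup>2 < e * n" using e by (simp add: field_simps)
  then show False using lower[of n] upper[of n] by simp
qed

text \<open>The norm of \<open>R\<close> cancels from the expanded inequality, so the discriminant
  bound applies with constant term 0.\<close>

lemma L2inner_zero_of_L2norm_minimal:
  fixes R V :: "'a \<Rightarrow> real ^ 'm"
  assumes R: "square_integrable M R" and V: "square_integrable M V"
    and min: "\<And>t. L2norm M R \<le> L2norm M (\<lambda>\<omega>. R \<omega> - t *\<^sub>R V \<omega>)"
  shows "L2inner M R V = 0"
proof -
  have "(L2inner M R V)\<^sup>2 \<le> 0 * (L2norm M V)\<^sup>2"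
  proof (rule square_le_of_nonneg_quadratic)
    fix t
    have "(L2norm M R)\<^sup>2 \<le> (L2norm M (\<lambda>\<omega>. R \<omega> - t *\<^sub>R V \<omega>))\<^sup>2"
      by (rule power_mono[OF min L2norm_nonneg])
    also have "\<dots> = (L2norm M R)\<^sup>2 + t\<^sup>2 * (L2norm M V)\<^sup>2 - 2 * (t * L2inner M R V)"
      unfolding L2norm_diff_power2[OF R square_integrable_scaleR[OF V]] L2inner_scaleR_right
      by (simp add: L2norm_power2 power_mult_distrib)
    finally show "2 * t * L2inner M R V \<le> 0 + t\<^sup>2 * (L2norm M V)\<^sup>2" by simp
  qed simp
  then show ?thesis by simp
qed

section \<open>Integrals of coordinates over events, written as L^2 inner products\<close>

context prob_subalgebra
begin

lemma square_integrable_indicator: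
  fixes v :: "real ^ 'm"
  assumes B: "B \<in> events"
  shows "square_integrable M (\<lambda>\<omega>. indicator B \<omega> *\<^sub>R v)"
  unfolding square_integrable_def
proof
  show "(\<lambda>\<omega>. indicator B \<omega> *\<^sub>R v) \<in> borel_measurable M" using B by measurable
  have "(\<lambda>\<omega>. (norm (indicator B \<omega> *\<^sub>R v))\<^sup>2) = (\<lambda>\<omega>. indicator B \<omega> * (norm v)\<^sup>2)"
    by (auto simp: indicator_def)
  then show "integrable M (\<lambda>\<omega>. (norm (indicator B \<omega> *\<^sub>R v))\<^sup>2)"
    using integrable_indicator_event[OF B] by simp
qed

lemma L2inner_indicator_axis:
  fixes f :: "'a \<Rightarrow> real ^ 'm"
  shows "L2inner M f (\<lambda>\<omega>. indicator B \<omega> *\<^sub>R axis i 1) = (\<integral>\<omega>\<in>B. f \<omega> $ i \<partial>M)"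
  by (simp add: L2inner_def set_lebesgue_integral_def inner_axis)

lemma integrable_component:
  fixes f :: "'a \<Rightarrow> real ^ 'm"
  assumes "square_integrable M f"
  shows "integrable M (\<lambda>\<omega>. f \<omega> $ i)"
proof -
  have "integrable M (\<lambda>\<omega>. f \<omega> \<bullet> (indicator (space M) \<omega> *\<^sub>R axis i 1))"
    by (rule integrable_inner_square_integrable[OF assms square_integrable_indicator]) simp
  then show ?thesis
    by (rule Bochner_Integration.integrable_cong[THEN iffD1, rotated -1])
      (auto simp: inner_axis)
qed

section \<open>A single greedy step: consequences of minimality\<close>

context
  fixes X Y :: "'a \<Rightarrow> real ^ 'm"
  assumes X: "square_integrable M X" and best: "best_indep_approx M A X Y"
begin

lemma best_indep_approx_square_integrable: "square_integrable M Y"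
  using best by (simp add: best_indep_approx_def)

lemma best_indep_approx_indep: "indep_of_subalgebra M A Y"
  using best by (simp add: best_indep_approx_def)

lemma best_indep_approx_le:
  assumes "square_integrable M Z" "indep_of_subalgebra M A Z"
  shows "L2norm M (\<lambda>\<omega>. X \<omega> - Y \<omega>) \<le> L2norm M (\<lambda>\<omega>. X \<omega> - Z \<omega>)"
  using best assms by (simp add: best_indep_approx_def)

lemma residual_square_integrable: "square_integrable M (\<lambda>\<omega>. X \<omega> - Y \<omega>)"
  by (rule square_integrable_diff[OF X best_indep_approx_square_integrable])

text \<open>All multiples of \<open>Y\<close> compete with \<open>Y\<close>, so the residual is
  orthogonal to \<open>Y\<close>, although \<open>Y\<close> is not a projection onto a
  subspace.\<close>

lemma L2inner_best_indep_approx: "L2inner M X Y = (L2norm M Y)\<^sup>2"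
proof -
  note Y = best_indep_approx_square_integrable
  have "L2inner M (\<lambda>\<omega>. X \<omega> - Y \<omega>) Y = 0"
  proof (rule L2inner_zero_of_L2norm_minimal[OF residual_square_integrable Y])
    fix t
    have "L2norm M (\<lambda>\<omega>. X \<omega> - Y \<omega>) \<le> L2norm M (\<lambda>\<omega>. X \<omega> - (1 + t) *\<^sub>R Y \<omega>)"
      by (intro best_indep_approx_le square_integrable_scaleR Y
          indep_of_subalgebra_compose[OF best_indep_approx_indep]) simp
    then show "L2norm M (\<lambda>\<omega>. X \<omega> - Y \<omega>) \<le> L2norm M (\<lambda>\<omega>. X \<omega> - Y \<omega> - t *\<^sub>R Y \<omega>)"
      by (simp add: algebra_simps)
  qed
  then show ?thesis
    by (simp add: L2inner_diff_left[OF X Y Y] L2inner_self)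
qed

lemma L2norm_residual_power2:
  "(L2norm M (\<lambda>\<omega>. X \<omega> - Y \<omega>))\<^sup>2 = (L2norm M X)\<^sup>2 - (L2norm M Y)\<^sup>2"
  unfolding L2norm_diff_power2[OF X best_indep_approx_square_integrable] L2inner_best_indep_approx
  by simp

text \<open>The multiples of \<open>Z\<close> compete with \<open>Y\<close>. By the Pythagorean
  identity for the residual, the resulting quadratic in \<open>t\<close> has constant term
  \<open>(L2norm M Y)\<^sup>2\<close>.\<close>

lemma L2inner_indep_le:
  assumes Z: "square_integrable M Z" and indep: "indep_of_subalgebra M A Z"
  shows "\<bar>L2inner M X Z\<bar> \<le> L2norm M Y * L2norm M Z"
proof -
  have "(L2inner M X Z)\<^sup>2 \<le> (L2norm M Y)\<^sup>2 * (L2norm M Z)\<^sup>2"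
  proof (rule square_le_of_nonneg_quadratic)
    fix t
    have "L2norm M (\<lambda>\<omega>. X \<omega> - Y \<omega>) \<le> L2norm M (\<lambda>\<omega>. X \<omega> - t *\<^sub>R Z \<omega>)"
      by (intro best_indep_approx_le square_integrable_scaleR Z
          indep_of_subalgebra_compose[OF indep]) simp
    then have "(L2norm M (\<lambda>\<omega>. X \<omega> - Y \<omega>))\<^sup>2 \<le> (L2norm M (\<lambda>\<omega>. X \<omega> - t *\<^sub>R Z \<omega>))\<^sup>2"
      by (rule power_mono) (rule L2norm_nonneg)
    also have "\<dots> = (L2norm M X)\<^sup>2 + t\<^sup>2 * (L2norm M Z)\<^sup>2 - 2 * (t * L2inner M X Z)"
      unfolding L2norm_diff_power2[OF X square_integrable_scaleR[OF Z]] L2inner_scaleR_right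
      by (simp add: L2norm_power2 power_mult_distrib)
    finally show "2 * t * L2inner M X Z \<le> (L2norm M Y)\<^sup>2 + t\<^sup>2 * (L2norm M Z)\<^sup>2"
      unfolding L2norm_residual_power2 by simp
  qed simp
  then have "\<bar>L2inner M X Z\<bar>\<^sup>2 \<le> (L2norm M Y * L2norm M Z)\<^sup>2"
    by (simp add: power_mult_distrib)
  then show ?thesis
    by (rule power2_le_imp_le) (simp add: L2norm_nonneg)
qed

text \<open>Translates of \<open>Y\<close> by constants compete too, so each coordinate of
  \<open>Y\<close> has the same mean as that of \<open>X\<close>, namely 0. By independence its
  integral over any event of \<open>A\<close> is then 0 as well. This carries the vanishing
  conditional expectation through the iteration.\<close>

lemma set_integral_residual_zero:
  assumes zero: "\<And>G. G \<in> sets A \<Longrightarrow> (\<integral>\<omega>\<in>G. X \<omega> $ i \<partial>M) = 0" and G: "G \<in> sets A"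
  shows "(\<integral>\<omega>\<in>G. (X \<omega> - Y \<omega>) $ i \<partial>M) = 0"
proof -
  note Y = best_indep_approx_square_integrable
  let ?V = "\<lambda>\<omega>. indicator (space M) \<omega> *\<^sub>R (axis i 1 :: real ^ 'm)"
  have V: "square_integrable M ?V" by (rule square_integrable_indicator) simp
  have "L2inner M (\<lambda>\<omega>. X \<omega> - Y \<omega>) ?V = 0"
  proof (rule L2inner_zero_of_L2norm_minimal[OF residual_square_integrable V])
    fix t
    \<comment> \<open>\<open>?V\<close> agrees with the coordinate vector only on
      \<open>space M\<close>, so the two perturbations have equal norms without being equal as
      functions.\<close>
    let ?Z = "\<lambda>\<omega>. Y \<omega> + t *\<^sub>R axis i 1"
    have Z_eq: "L2norm M (\<lambda>\<omega>. X \<omega> - Y \<omega> - t *\<^sub>R ?V \<omega>) = L2norm M (\<lambda>\<omega>. X \<omega> - ?Z \<omega>)"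
      unfolding L2norm_def
      by (intro arg_cong[where f=sqrt] Bochner_Integration.integral_cong) (auto simp: algebra_simps)
    have "(\<lambda>\<omega>. t *\<^sub>R axis i 1 :: real ^ 'm) \<in> borel_measurable M" by simp
    then have "square_integrable M (\<lambda>\<omega>. t *\<^sub>R axis i 1 :: real ^ 'm)"
      by (simp add: square_integrable_def)
    then have "square_integrable M ?Z" by (rule square_integrable_add[OF Y])
    moreover have "indep_of_subalgebra M A ?Z"
      by (rule indep_of_subalgebra_compose[OF best_indep_approx_indep]) simp
    ultimately show "L2norm M (\<lambda>\<omega>. X \<omega> - Y \<omega>) \<le> L2norm M (\<lambda>\<omega>. X \<omega> - Y \<omega> - t *\<^sub>R ?V \<omega>)"
      unfolding Z_eq by (rule best_indep_approx_le)
  qed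
  then have "(\<integral>\<omega>\<in>space M. X \<omega> $ i \<partial>M) = (\<integral>\<omega>\<in>space M. Y \<omega> $ i \<partial>M)"
    unfolding L2inner_diff_left[OF X Y V] L2inner_indicator_axis by simp
  moreover have "(\<integral>\<omega>\<in>space M. X \<omega> $ i \<partial>M) = 0"
    by (rule zero) (metis sets.top space_subalgebra)
  ultimately have "expectation (\<lambda>\<omega>. Y \<omega> $ i) = 0"
    by (simp add: set_integral_space integrable_component[OF Y])
  moreover have "indep_of_subalgebra M A (\<lambda>\<omega>. Y \<omega> $ i)"
    by (rule indep_of_subalgebra_compose[OF best_indep_approx_indep]) simp
  ultimately have "(\<integral>\<omega>\<in>G. Y \<omega> $ i \<partial>M) = 0"
    using set_integral_indep_of_subalgebra[OF _ integrable_component[OF Y] G] by simp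
  then show ?thesis
    using L2inner_diff_left[OF X Y square_integrable_indicator[OF subalgebra_sets[OF G]], of "axis i 1"]
      zero[OF G]
    by (simp only: L2inner_indicator_axis)
qed

end

section \<open>The iteration: energy identity, Cauchy property and limit\<close>

context
  fixes X Y :: "nat \<Rightarrow> 'a \<Rightarrow> real ^ 'm"
  assumes X: "\<And>n. square_integrable M (X n)"
    and best: "\<And>n. best_indep_approx M A (X n) (Y n)"
    and X_Suc: "\<And>n. AE \<omega> in M. X (Suc n) \<omega> = X n \<omega> - Y n \<omega>"
begin

lemma greedy_square_integrable: "square_integrable M (Y n)"
  by (rule best_indep_approx_square_integrable[OF X best])

lemma greedy_residual_square_integrable: "square_integrable M (\<lambda>\<omega>. X n \<omega> - Y n \<omega>)"
  by (rule square_integrable_diff[OF X greedy_square_integrable])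

lemma greedy_L2norm_Suc: "(L2norm M (X (Suc n)))\<^sup>2 = (L2norm M (X n))\<^sup>2 - (L2norm M (Y n))\<^sup>2"
  using L2norm_cong_AE[OF X greedy_residual_square_integrable X_Suc]
    L2norm_residual_power2[OF X best] by simp

lemma greedy_sum_L2norm:
  "(\<Sum>k<n. (L2norm M (Y k))\<^sup>2) = (L2norm M (X 0))\<^sup>2 - (L2norm M (X n))\<^sup>2"
  by (induction n) (simp_all add: greedy_L2norm_Suc)

text \<open>Descending induction from \<open>n = m\<close>: passing from \<open>X (Suc n)\<close>
  back to \<open>X n\<close> adds the inner product of \<open>Y n\<close> with \<open>X m\<close>.
  As \<open>Y n\<close> is independent of \<open>A\<close>, the best approximation at stage
  \<open>m\<close> bounds this by \<open>L2norm M (Y m) * L2norm M (Y n)\<close>.\<close>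

lemma greedy_L2inner_ge:
  assumes "n \<le> m"
  shows "(L2norm M (X m))\<^sup>2 - L2norm M (Y m) * (\<Sum>j=n..<m. L2norm M (Y j)) \<le> L2inner M (X n) (X m)"
  using assms
proof (induction rule: inc_induct)
  case base
  show ?case by (simp add: L2inner_self)
next
  case (step n)
  have "L2inner M (X (Suc n)) (X m) = L2inner M (X n) (X m) - L2inner M (Y n) (X m)"
    using L2inner_cong_AE[OF X greedy_residual_square_integrable X X_Suc]
      L2inner_diff_left[OF X greedy_square_integrable X] by simp
  moreover have "\<bar>L2inner M (X m) (Y n)\<bar> \<le> L2norm M (Y m) * L2norm M (Y n)"
    by (rule L2inner_indep_le[OF X best greedy_square_integrable best_indep_approx_indep[OF X best]])
  ultimately show ?case
    using step by (simp add: L2inner_commute[of M "Y n"] sum.atLeast_Suc_lessThan distrib_left)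
qed

text \<open>The lower bound on the inner product enters the expansion of the squared distance. The
  sum is enlarged to all indices up to \<open>m\<close>, so that the error term depends on
  \<open>m\<close> alone.\<close>

lemma greedy_L2norm_diff:
  assumes "n \<le> m"
  shows "(L2norm M (\<lambda>\<omega>. X n \<omega> - X m \<omega>))\<^sup>2
    \<le> (L2norm M (X n))\<^sup>2 - (L2norm M (X m))\<^sup>2 + 2 * (L2norm M (Y m) * (\<Sum>j\<le>m. L2norm M (Y j)))"
proof -
  have "L2norm M (Y m) * (\<Sum>j=n..<m. L2norm M (Y j)) \<le> L2norm M (Y m) * (\<Sum>j\<le>m. L2norm M (Y j))"
    by (intro mult_left_mono sum_mono2 L2norm_nonneg) auto
  then show ?thesis
    using greedy_L2inner_ge[OF assms] L2norm_diff_power2[OF X X, of n m] by simp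
qed

lemma greedy_summable: "summable (\<lambda>n. (L2norm M (Y n))\<^sup>2)"
  by (rule bounded_imp_summable[of _ "(L2norm M (X 0))\<^sup>2"])
    (simp_all add: lessThan_Suc_atMost[symmetric] greedy_sum_L2norm)

lemma greedy_Cauchy:
  assumes e: "0 < e"
  shows "\<exists>N. \<forall>m\<ge>N. \<forall>n\<ge>N. L2norm M (\<lambda>\<omega>. X m \<omega> - X n \<omega>) \<le> e"
proof -
  \<comment> \<open>The squared distance is bounded by one error below \<open>\<delta>\<close> plus
    twice another, hence the division by 3; the target \<open>e / 2\<close> leaves room for two
    distances.\<close>
  define \<delta> where "\<delta> = (e / 2)\<^sup>2 / 3"
  have \<delta>: "0 < \<delta>" using e by (simp add: \<delta>_def)
  have sq: "(\<lambda>n. (L2norm M (X n))\<^sup>2) = (\<lambda>n. (L2norm M (X 0))\<^sup>2 - (\<Sum>k<n. (L2norm M (Y k))\<^sup>2))"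
    by (simp add: greedy_sum_L2norm)
  have "convergent (\<lambda>n. (L2norm M (X n))\<^sup>2)"
    unfolding sq using greedy_summable
    by (intro convergent_diff) (auto simp: convergent_const summable_iff_convergent)
  then obtain N where N: "\<And>m n. N \<le> m \<Longrightarrow> N \<le> n \<Longrightarrow>
      norm ((L2norm M (X m))\<^sup>2 - (L2norm M (X n))\<^sup>2) < \<delta>"
    using CauchyD[OF convergent_Cauchy \<delta>] by blast
  have "L2norm M (\<lambda>\<omega>. X p \<omega> - X q \<omega>) \<le> e" if pq: "N \<le> p" "N \<le> q" for p q
  proof -
    \<comment> \<open>The error term is known to be small only for suitable \<open>m\<close>, so
      \<open>X p\<close> and \<open>X q\<close> are both compared with one such later
      \<open>X m\<close>.\<close>
    obtain m where m: "max p q \<le> m" "L2norm M (Y m) * (\<Sum>j\<le>m. L2norm M (Y j)) < \<delta>"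
      using square_summable_mult_sum_small[OF L2norm_nonneg greedy_summable \<delta>] by blast
    have "L2norm M (\<lambda>\<omega>. X n \<omega> - X m \<omega>) \<le> e / 2" if "N \<le> n" "n \<le> m" for n
    proof (rule power2_le_imp_le)
      show "(L2norm M (\<lambda>\<omega>. X n \<omega> - X m \<omega>))\<^sup>2 \<le> (e / 2)\<^sup>2"
        using greedy_L2norm_diff[OF that(2)] N[OF that(1) order_trans[OF that]] m(2)
        unfolding \<delta>_def real_norm_def by linarith
    qed (use e in simp)
    from this[OF pq(1)] this[OF pq(2)] show ?thesis
      using L2norm_triangle[OF X X X, of p q m] m(1) by simp
  qed
  then show ?thesis by blast
qed

lemma greedy_set_integral_zero:
  assumes "\<And>i G. G \<in> sets A \<Longrightarrow> (\<integral>\<omega>\<in>G. X 0 \<omega> $ i \<partial>M) = 0" and "G \<in> sets A"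
  shows "(\<integral>\<omega>\<in>G. X n \<omega> $ i \<partial>M) = 0"
  using assms(2)
proof (induction n arbitrary: G)
  case 0
  then show ?case by (rule assms(1))
next
  case (Suc n)
  have "(\<integral>\<omega>\<in>G. X (Suc n) \<omega> $ i \<partial>M) = (\<integral>\<omega>\<in>G. (X n \<omega> - Y n \<omega>) $ i \<partial>M)"
    unfolding L2inner_indicator_axis[symmetric]
    by (rule L2inner_cong_AE[OF X greedy_residual_square_integrable
          square_integrable_indicator[OF subalgebra_sets[OF Suc.prems]] X_Suc])
  also have "\<dots> = 0"
    by (rule set_integral_residual_zero[OF X best]) (use Suc in auto)
  finally show ?case .
qed

text \<open>Inner products pass to the L^2 limit \<open>g\<close>. Since the norms of
  \<open>Y n\<close> tend to 0, \<open>g\<close> is orthogonal to every square integrable variable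
  independent of \<open>A\<close>; its coordinates also keep zero integral over events of
  \<open>A\<close>. Conditional atomlessness then makes each coordinate vanish.\<close>

lemma greedy_L2norm_tendsto_0:
  assumes atomless: "conditionally_atomless M A"
    and zero: "\<And>i G. G \<in> sets A \<Longrightarrow> (\<integral>\<omega>\<in>G. X 0 \<omega> $ i \<partial>M) = 0"
  shows "(\<lambda>n. L2norm M (X n)) \<longlonglongrightarrow> 0"
proof -
  obtain g where g: "square_integrable M g"
    and lim: "(\<lambda>n. L2norm M (\<lambda>\<omega>. X n \<omega> - g \<omega>)) \<longlonglongrightarrow> 0"
    using L2_complete[OF X greedy_Cauchy] by blast
  have inner_lim: "(\<lambda>n. L2inner M (X n) V) \<longlonglongrightarrow> L2inner M g V"
    if V: "square_integrable M V" for V :: "'a \<Rightarrow> real ^ 'm"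
  proof (rule LIM_zero_cancel)
    have "(\<lambda>n. L2norm M (\<lambda>\<omega>. X n \<omega> - g \<omega>) * L2norm M V) \<longlonglongrightarrow> 0"
      by (rule tendsto_mult_left_zero[OF lim])
    then show "(\<lambda>n. L2inner M (X n) V - L2inner M g V) \<longlonglongrightarrow> 0"
      by (rule Lim_null_comparison[rotated])
        (use L2_Cauchy_Schwarz[OF square_integrable_diff[OF X g] V] in
          \<open>simp add: L2inner_diff_left[OF X g V]\<close>)
  qed
  have Y_lim: "(\<lambda>n. L2norm M (Y n)) \<longlonglongrightarrow> 0"
    using tendsto_real_sqrt[OF summable_LIMSEQ_zero[OF greedy_summable]]
    by (simp add: L2norm_nonneg)
  have orth: "L2inner M g Z = 0"
    if Z: "square_integrable M Z" "indep_of_subalgebra M A Z" for Z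
  proof (rule LIMSEQ_unique[OF inner_lim[OF Z(1)]])
    have "(\<lambda>n. L2norm M (Y n) * L2norm M Z) \<longlonglongrightarrow> 0"
      by (rule tendsto_mult_left_zero[OF Y_lim])
    then show "(\<lambda>n. L2inner M (X n) Z) \<longlonglongrightarrow> 0"
      by (rule Lim_null_comparison[rotated]) (use L2inner_indep_le[OF X best Z] in simp)
  qed
  have "AE \<omega> in M. g \<omega> $ i = 0" for i
  proof (rule AE_zero_of_orthogonal_indep[OF atomless integrable_component[OF g]])
    fix G assume G: "G \<in> sets A"
    have V: "square_integrable M (\<lambda>\<omega>. indicator G \<omega> *\<^sub>R axis i 1 :: real ^ 'm)"
      by (rule square_integrable_indicator[OF subalgebra_sets[OF G]])
    show "(\<integral>\<omega>\<in>G. g \<omega> $ i \<partial>M) = 0"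
      using inner_lim[OF V] greedy_set_integral_zero[OF zero G]
      by (simp add: L2inner_indicator_axis LIMSEQ_const_iff)
  next
    fix B assume B: "B \<in> events" "AE \<omega> in M. cond_prob B \<omega> = 1/2"
    \<comment> \<open>An event of constant conditional probability, times a coordinate vector, is
      independent of \<open>A\<close> and hence an admissible test variable in
      \<open>orth\<close>.\<close>
    show "(\<integral>\<omega>\<in>B. g \<omega> $ i \<partial>M) = 0"
      unfolding L2inner_indicator_axis[symmetric]
      by (rule orth[OF square_integrable_indicator[OF B(1)] indep_of_subalgebra_indicator[OF B]])
  qed
  then have "AE \<omega> in M. \<forall>i\<in>UNIV. g \<omega> $ i = 0" by (intro AE_finite_allI) auto
  then have g0: "AE \<omega> in M. g \<omega> = 0" by eventually_elim (simp add: vec_eq_iff)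
  have "L2norm M (\<lambda>\<omega>. X n \<omega> - g \<omega>) = L2norm M (X n)" for n
    by (rule L2norm_cong_AE[OF square_integrable_diff[OF X g] X])
      (use g0 in \<open>eventually_elim, simp\<close>)
  then show ?thesis using lim by simp
qed

end

lemma set_integral_zero_of_vec_cond_exp_zero:
  fixes Z :: "'a \<Rightarrow> real ^ 'm"
  assumes Z: "square_integrable M Z" and zero: "AE \<omega> in M. vec_cond_exp M A Z \<omega> = 0"
    and G: "G \<in> sets A"
  shows "(\<integral>\<omega>\<in>G. Z \<omega> $ i \<partial>M) = 0"
proof -
  note int = integrable_component[OF Z, of i]
  have [measurable]: "G \<in> events" using G by (rule subalgebra_sets)
  have "AE \<omega> in M. real_cond_exp M A (\<lambda>\<nu>. Z \<nu> $ i) \<omega> = 0"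
    using zero by eventually_elim (simp add: vec_cond_exp_def vec_eq_iff)
  then have "(\<integral>\<omega>\<in>G. real_cond_exp M A (\<lambda>\<nu>. Z \<nu> $ i) \<omega> \<partial>M) = (\<integral>\<omega>\<in>G. 0 \<partial>M)"
    unfolding set_lebesgue_integral_def by (intro integral_cong_AE) auto
  then show ?thesis using real_cond_exp_intA[OF int G] by simp
qed

end

section \<open>Convergence and the energy identity for sequences indexed from 1\<close>

theorem theorem4p2:
  fixes M A :: "'a measure"
    and X\<^sub>0 :: "'a \<Rightarrow> real ^ 'm"
    and X Y :: "nat \<Rightarrow> 'a \<Rightarrow> real ^ 'm"
  assumes "prob_space M"
    and "subalgebra M A"
    and "conditionally_atomless M A"
    and "square_integrable M X\<^sub>0"
    and "AE \<omega> in M. vec_cond_exp M A X\<^sub>0 \<omega> = 0"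
    and "\<And>n. n \<ge> 1 \<Longrightarrow> square_integrable M (X n)"
    and "\<And>n. n \<ge> 1 \<Longrightarrow> square_integrable M (Y n)"
    and "AE \<omega> in M. X 1 \<omega> = X\<^sub>0 \<omega>"
    and "\<And>n. n \<ge> 1 \<Longrightarrow> best_indep_approx M A (X n) (Y n)"
    and "\<And>n. n \<ge> 1 \<Longrightarrow> AE \<omega> in M. X (n + 1) \<omega> = X n \<omega> - Y n \<omega>"
  shows "(\<lambda>n. L2norm M (X n)) \<longlonglongrightarrow> 0 \<and>
    (\<lambda>n. L2norm M (\<lambda>\<omega>. X 1 \<omega> - (\<Sum>k = 1..n. Y k \<omega>))) \<longlonglongrightarrow> 0 \<and>
    (\<lambda>k. (L2norm M (Y (Suc k)))\<^sup>2) sums (L2norm M (X 1))\<^sup>2"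
proof -
  interpret prob_subalgebra M A
    using assms(1,2) by (simp add: prob_subalgebra_def prob_subalgebra_axioms_def)
  \<comment> \<open>The iteration was treated from index 0, so both sequences are shifted by
    one.\<close>
  define X' where "X' n = X (Suc n)" for n
  define Y' where "Y' n = Y (Suc n)" for n
  have X': "square_integrable M (X' n)" for n using assms(6) by (simp add: X'_def)
  have best: "best_indep_approx M A (X' n) (Y' n)" for n
    using assms(9) by (simp add: X'_def Y'_def)
  have X'_Suc: "AE \<omega> in M. X' (Suc n) \<omega> = X' n \<omega> - Y' n \<omega>" for n
    using assms(10)[of "Suc n"] by (simp add: X'_def Y'_def)
  have "(\<integral>\<omega>\<in>G. X' 0 \<omega> $ i \<partial>M) = 0" if G: "G \<in> sets A" for G i
  proof -
    have "(\<integral>\<omega>\<in>G. X' 0 \<omega> $ i \<partial>M) = (\<integral>\<omega>\<in>G. X\<^sub>0 \<omega> $ i \<partial>M)"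
      unfolding L2inner_indicator_axis[symmetric]
      by (rule L2inner_cong_AE[OF X' assms(4) square_integrable_indicator[OF subalgebra_sets[OF G]]])
        (use assms(8) in \<open>simp add: X'_def\<close>)
    then show ?thesis
      using set_integral_zero_of_vec_cond_exp_zero[OF assms(4,5) G] by simp
  qed
  then have lim: "(\<lambda>n. L2norm M (X (Suc n))) \<longlonglongrightarrow> 0"
    using greedy_L2norm_tendsto_0[where X = X' and Y = Y', OF X' best X'_Suc assms(3)] by (simp add: X'_def)
  \<comment> \<open>The recursion telescopes almost everywhere: the remainder after \<open>n\<close>
    terms of the series is \<open>X (Suc n)\<close>.\<close>
  moreover have "L2norm M (\<lambda>\<omega>. X 1 \<omega> - (\<Sum>k = 1..n. Y k \<omega>)) = L2norm M (X (Suc n))" for n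
  proof -
    have "AE \<omega> in M. X 1 \<omega> - (\<Sum>k = 1..n. Y k \<omega>) = X (Suc n) \<omega>"
    proof (induction n)
      case (Suc n)
      have "AE \<omega> in M. X (Suc (Suc n)) \<omega> = X (Suc n) \<omega> - Y (Suc n) \<omega>"
        using assms(10)[of "Suc n"] by simp
      with Suc show ?case by eventually_elim (simp add: algebra_simps)
    qed simp
    moreover from this have "AE \<omega> in M. X (Suc n) \<omega> = X 1 \<omega> - (\<Sum>k = 1..n. Y k \<omega>)"
      by eventually_elim simp
    then have "square_integrable M (\<lambda>\<omega>. X 1 \<omega> - (\<Sum>k = 1..n. Y k \<omega>))"
      using assms(6,7) by (intro square_integrable_AE_cong[OF assms(6)[of "Suc n"]])
        (auto intro!: borel_measurable_diff borel_measurable_sum square_integrable_measurable)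
    ultimately show ?thesis by (intro L2norm_cong_AE assms(6)) simp_all
  qed
  moreover have "(\<lambda>k. (L2norm M (Y (Suc k)))\<^sup>2) sums (L2norm M (X 1))\<^sup>2"
  proof -
    \<comment> \<open>By the telescoped Pythagorean identity, this sequence consists of the partial
      sums of the squared norms.\<close>
    have "(\<lambda>n. (L2norm M (X 1))\<^sup>2 - (L2norm M (X (Suc n)))\<^sup>2) \<longlonglongrightarrow> (L2norm M (X 1))\<^sup>2 - 0\<^sup>2"
      by (intro tendsto_intros lim)
    then show ?thesis
      using greedy_sum_L2norm[where X = X' and Y = Y', OF X' best X'_Suc] by (simp add: sums_def X'_def Y'_def)
  qed
  ultimately show ?thesis by (simp add: filterlim_sequentially_Suc[of "\<lambda>n. L2norm M (X n)"])
qed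

end
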